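(* Let $\eta$ be a Poisson process on $\mathbb X$ with locally finite intensity measure $\lambda$. Suppose that $Z_1,Z_2,\dots$ are stopping sets such that $Z_n\uparrow Z$ for some $Z:\mathbf N\to\mathcal X$ (i.e. $Z_n(\mu)\subset Z_{n+1}(\mu)$ and $Z(\mu)=\bigcup_nZ_n(\mu)$ for all $\mu\in\mathbf N$). Then $Z$ is a stopping set. If, moreover, $\mathbb P(\eta(Z_n(\eta))<\infty)=1$ for each $n\in\mathbb N$, then for each $A\in\mathcal N$, $$\mathbb P(\eta_{Z(\eta)^c}\in A\mid\eta_{Z(\eta)})=\Pi_{\lambda_{Z(\eta)^c}}(A),\quad\mathbb P\text{-a.s.}$$
   Context: $(\mathbb X,\mathcal X)$ is a Borel space (measurably isomorphic to a Borel subset of $[0,1]$). Fix an increasing sequence $B_n\in\mathcal X$ with $B_n\uparrow\mathbb X$, and let $\mathcal X_0:=\{B\cap B_n:B\in\mathcal X,n\in\mathbb N\}$. A measure on $\mathbb X$ is locally finite if it is finite on $\mathcal X_0$. $\mathbf N$ is the set of all measures on $\mathbb X$ that are $\mathbb N_0$-valued on $\mathcal X_0$, with the $\sigma$-field $\mathcal N$ generated by $\mu\mapsto\mu(B)$, $B\in\mathcal X$. For a measure $\nu$ and $B\in\mathcal X$, $\nu_B:=\nu(\cdot\cap B)$. A Poisson process with intensity $\lambda$ is a random element $\eta$ of $\mathbf N$ with $\eta(B)$ Poisson of mean $\lambda(B)$ and independent values on disjoint sets; $\Pi_\nu$ denotes the law on $\mathbf N$ of a Poisson process with intensity measure $\nu$.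 Stopping set: a map $Z:\mathbf N\to\mathcal X$ such that $(x,\mu)\mapsto\mathbf 1\{x\in Z(\mu)\}$ is measurable on $\mathbb X\times\mathbf N$ (graph-measurability) and $Z(\mu)=Z(\mu_{Z(\mu)}+\psi_{Z(\mu)^c})$ for all $\mu,\psi\in\mathbf N$, where $Z(\mu)^c:=\mathbb X\setminus Z(\mu)$. *)

theory Defs
  imports "HOL-Probability.Probability"
begin

text \<open>In the following, only the space and the sigma-field of \<open>M\<close> matter: \<open>M\<close> stands for the
  measurable space of points, and measures on it are the \<open>\<mu>\<close> with \<open>sets \<mu> = sets M\<close>.\<close>

definition borel_isomorphic_space :: "'a measure \<Rightarrow> bool" where
  "borel_isomorphic_space M \<longleftrightarrow>
    (\<exists>S\<in>sets (borel :: real measure). S \<subseteq> {0..1} \<and>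
      (\<exists>f\<in>measurable M (restrict_space borel S). \<exists>g\<in>measurable (restrict_space borel S) M.
        (\<forall>x\<in>space M. g (f x) = x) \<and> (\<forall>y\<in>S. f (g y) = y)))"

definition localizing_seq :: "'a measure \<Rightarrow> (nat \<Rightarrow> 'a set) \<Rightarrow> bool" where
  "localizing_seq M Bs \<longleftrightarrow> range Bs \<subseteq> sets M \<and> incseq Bs \<and> (\<Union>n. Bs n) = space M"

definition bounded_sets :: "'a measure \<Rightarrow> (nat \<Rightarrow> 'a set) \<Rightarrow> 'a set set" where
  "bounded_sets M Bs = {B \<inter> Bs n | B n. B \<in> sets M}"

definition locally_finite :: "'a measure \<Rightarrow> (nat \<Rightarrow> 'a set) \<Rightarrow> 'a measure \<Rightarrow> bool" where
  "locally_finite M Bs \<nu> \<longleftrightarrow> sets \<nu> = sets M \<and> (\<forall>B\<in>bounded_sets M Bs. emeasure \<nu> B < \<infinity>)"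

definition counting_measures :: "'a measure \<Rightarrow> (nat \<Rightarrow> 'a set) \<Rightarrow> 'a measure set" where
  "counting_measures M Bs =
    {\<mu>. sets \<mu> = sets M \<and> (\<forall>B\<in>bounded_sets M Bs. \<exists>k::nat. emeasure \<mu> B = of_nat k)}"

text \<open>The sigma-field generated by the evaluation maps, built in the same way as
  \<^const>\<open>subprob_algebra\<close>.\<close>

definition counting_algebra :: "'a measure \<Rightarrow> (nat \<Rightarrow> 'a set) \<Rightarrow> 'a measure measure" where
  "counting_algebra M Bs =
    (SUP B \<in> sets M. vimage_algebra (counting_measures M Bs) (\<lambda>\<mu>. emeasure \<mu> B) borel)"

lemma space_counting_algebra: "space (counting_algebra M Bs) = counting_measures M Bs"
  using sets.empty_sets[of M] unfolding counting_algebra_def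
  by (subst space_Sup_eq_UN) (simp, force simp del: sets.empty_sets)

lemma measurable_emeasure_counting_algebra:
  "B \<in> sets M \<Longrightarrow> (\<lambda>\<mu>. emeasure \<mu> B) \<in> borel_measurable (counting_algebra M Bs)"
  unfolding counting_algebra_def
  by (auto intro!: measurable_Sup1 measurable_vimage_algebra1)

text \<open>The measure \<open>\<mu>(\<cdot> \<inter> B)\<close>. Unlike \<^const>\<open>restrict_space\<close>, it keeps the
  underlying measurable space.\<close>

definition restr :: "'a measure \<Rightarrow> 'a set \<Rightarrow> 'a measure" where
  "restr \<mu> B = measure_of (space \<mu>) (sets \<mu>) (\<lambda>A. emeasure \<mu> (A \<inter> B))"

definition add_measure :: "'a measure \<Rightarrow> 'a measure \<Rightarrow> 'a measure" where
  "add_measure \<mu> \<psi> = measure_of (space \<mu>) (sets \<mu>) (\<lambda>A. emeasure \<mu> A + emeasure \<psi> A)"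

lemma sets_restr [simp]: "sets (restr \<mu> B) = sets \<mu>"
  and space_restr [simp]: "space (restr \<mu> B) = space \<mu>"
  by (simp_all add: restr_def)

lemma sets_add_measure [simp]: "sets (add_measure \<mu> \<psi>) = sets \<mu>"
  and space_add_measure [simp]: "space (add_measure \<mu> \<psi>) = space \<mu>"
  by (simp_all add: add_measure_def)

lemma emeasure_restr:
  assumes "B \<in> sets \<mu>" "A \<in> sets \<mu>"
  shows "emeasure (restr \<mu> B) A = emeasure \<mu> (A \<inter> B)"
proof -
  have "countably_additive (sets \<mu>) (\<lambda>A. emeasure \<mu> (A \<inter> B))"
  proof (rule countably_additiveI)
    fix F :: "nat \<Rightarrow> _"
    assume F: "range F \<subseteq> sets \<mu>" "disjoint_family F"
    have "(\<Sum>i. emeasure \<mu> (F i \<inter> B)) = emeasure \<mu> (\<Union>i. F i \<inter> B)"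
      using F assms by (intro suminf_emeasure) (auto simp: disjoint_family_on_def)
    then show "(\<Sum>i. emeasure \<mu> (F i \<inter> B)) = emeasure \<mu> (\<Union> (range F) \<inter> B)"
      by (simp only: Int_UN_distrib2 UN_simps)
  qed
  then show ?thesis
    unfolding restr_def using assms
    by (intro emeasure_measure_of_sigma) (auto simp: positive_def sets.sigma_algebra_axioms)
qed

lemma emeasure_add_measure:
  assumes "sets \<psi> = sets \<mu>" "A \<in> sets \<mu>"
  shows "emeasure (add_measure \<mu> \<psi>) A = emeasure \<mu> A + emeasure \<psi> A"
proof -
  have "countably_additive (sets \<mu>) (\<lambda>A. emeasure \<mu> A + emeasure \<psi> A)"
  proof (rule countably_additiveI)
    fix F :: "nat \<Rightarrow> _"
    assume F: "range F \<subseteq> sets \<mu>" "disjoint_family F"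
    then show "(\<Sum>i. emeasure \<mu> (F i) + emeasure \<psi> (F i))
        = emeasure \<mu> (\<Union> (range F)) + emeasure \<psi> (\<Union> (range F))"
      using assms by (simp add: suminf_add[symmetric] suminf_emeasure)
  qed
  then show ?thesis
    unfolding add_measure_def using assms
    by (intro emeasure_measure_of_sigma) (auto simp: positive_def sets.sigma_algebra_axioms)
qed

definition stopping_set ::
    "'a measure \<Rightarrow> (nat \<Rightarrow> 'a set) \<Rightarrow> ('a measure \<Rightarrow> 'a set) \<Rightarrow> bool" where
  "stopping_set M Bs Z \<longleftrightarrow>
    Z \<in> counting_measures M Bs \<rightarrow> sets M \<and>
    (\<lambda>(x, \<mu>). indicator (Z \<mu>) x :: real) \<in> borel_measurable (M \<Otimes>\<^sub>M counting_algebra M Bs) \<and>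
    (\<forall>\<mu>\<in>counting_measures M Bs. \<forall>\<psi>\<in>counting_measures M Bs.
      Z \<mu> = Z (add_measure (restr \<mu> (Z \<mu>)) (restr \<psi> (space M - Z \<mu>))))"

text \<open>The Poisson distribution with mean \<open>m \<in> [0,\<infinity>]\<close> on the extended naturals; it is
  concentrated at \<open>0\<close> if \<open>m = 0\<close> (which \<^const>\<open>poisson_pmf\<close> excludes) and, by the usual
  convention, at \<open>\<infinity>\<close> if \<open>m = \<infinity>\<close>.\<close>

definition poisson_distributed :: "'w measure \<Rightarrow> ('w \<Rightarrow> ennreal) \<Rightarrow> ennreal \<Rightarrow> bool" where
  "poisson_distributed P X m \<longleftrightarrow>
    (if m = \<infinity> then \<P>(\<omega> in P. X \<omega> = \<infinity>) = 1
     else \<forall>k::nat. \<P>(\<omega> in P. X \<omega> = of_nat k) = enn2real m ^ k / fact k * exp (- enn2real m))"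

definition poisson_process ::
    "'a measure \<Rightarrow> (nat \<Rightarrow> 'a set) \<Rightarrow> 'a measure \<Rightarrow> 'w measure \<Rightarrow> ('w \<Rightarrow> 'a measure) \<Rightarrow> bool" where
  "poisson_process M Bs \<nu> P \<eta> \<longleftrightarrow>
    prob_space P \<and> sets \<nu> = sets M \<and>
    \<eta> \<in> measurable P (counting_algebra M Bs) \<and>
    (\<forall>C\<in>sets M. poisson_distributed P (\<lambda>\<omega>. emeasure (\<eta> \<omega>) C) (emeasure \<nu> C)) \<and>
    (\<forall>(m::nat) C. (\<forall>i<m. C i \<in> sets M) \<and> disjoint_family_on C {..<m} \<longrightarrow>
      prob_space.indep_vars P (\<lambda>_. borel) (\<lambda>i \<omega>. emeasure (\<eta> \<omega>) (C i)) {..<m})"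

text \<open>The law of a Poisson process with intensity \<open>\<nu>\<close>: the probability measure on
  \<^const>\<open>counting_algebra\<close> under which the canonical process (the identity) is such a process.
  It exists and is unique if \<open>\<nu>\<close> is locally finite.\<close>

definition poisson_law :: "'a measure \<Rightarrow> (nat \<Rightarrow> 'a set) \<Rightarrow> 'a measure \<Rightarrow> 'a measure measure" where
  "poisson_law M Bs \<nu> =
    (THE Q. sets Q = sets (counting_algebra M Bs) \<and> poisson_process M Bs \<nu> Q (\<lambda>\<mu>. \<mu>))"

end

theory Submission
  imports Defs
begin

text \<open>
  For a stopping set \<open>Z\<close> and a bounded set \<open>B\<close>, the region \<open>D = B - Z\<close> does not change when a
  point of \<open>D \<mu>\<close> is inserted into or removed from \<open>\<mu>\<close>. Hence the Mecke equation reads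
  \<open>E [\<eta>(D \<eta>) F(\<eta>)] = E [K F(\<eta>)]\<close>, where \<open>K F(\<mu>)\<close> is the integral of \<open>F(\<mu> + \<delta>\<^sub>x)\<close> with respect to
  \<open>\<Lambda>(dx)\<close> over \<open>D \<mu>\<close>, and by induction
  \<open>k! E [1{\<eta>(D \<eta>) = k} F(\<eta>)] = E [1{\<eta>(D \<eta>) = 0} K\<^sup>k F(\<eta>)]\<close>, so that
  \<open>E [F(\<eta>)] = E [1{\<eta>(D \<eta>) = 0} exp(K) F(\<eta>)]\<close>. For constant \<open>D = C\<close> this expresses
  \<open>E [F(\<zeta> + \<eta>\<^sub>C)]\<close> as \<open>exp(-\<Lambda>(C)) exp(K) F(\<zeta>)\<close>, which gives uniqueness of the Poisson law. In general it
  shows that replacing \<open>\<eta>\<close> on \<open>D \<eta>\<close> by an independent copy does not change the law: the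
  function obtained from \<open>F\<close> by averaging over the copy is multiplied by \<open>\<Lambda>(D)\<close> under \<open>K\<close>. Letting
  \<open>B\<close> increase to the whole space, \<open>\<eta>\<close> may be resampled on the complement of \<open>Z \<eta>\<close>; as \<open>Z\<close> depends
  only on what it contains, this is the claimed conditional distribution.
\<close>

section \<open>Integer-valued measures\<close>

text \<open>A stopping set reacts only to the points it contains, so a point outside it can be added
  or deleted unnoticed. Both directions matter: the Mecke equation evaluates the region after an
  insertion, the operator K before it. The truncation to a bounded set is forced by the exponential.
  The complement of a stopping set may carry infinitely many points and infinite intensity; then the
  events of exactly k points no longer exhaust the space, and exp(\<Lambda>(D)) cannot cancel the
  void probability exp(-\<Lambda>(D)). The definition of a Poisson process speaks only of single
  counts and of counts of disjoint sets. The Mecke equation is therefore built up from the recursion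
  of the Poisson weights, applied to a set that every other set under consideration either contains
  or avoids; general events and integrands follow by intersection-stable generators and monotone
  limits. Points are never enumerated as random elements: insertion into the measure and integration
  against it suffice.\<close>

lemma (in prob_space) indep_vars_finiteI:
  assumes "finite I" "\<And>i. i \<in> I \<Longrightarrow> random_variable (M' i) (X i)"
    and "\<And>A. (\<And>i. i \<in> I \<Longrightarrow> A i \<in> sets (M' i)) \<Longrightarrow> I \<noteq> {} \<Longrightarrow>
      prob (\<Inter>i\<in>I. X i -` A i \<inter> space M) = (\<Prod>i\<in>I. prob (X i -` A i \<inter> space M))"
  shows "indep_vars M' X I"
proof (cases "I = {}")
  case True
  then show ?thesis by (simp add: indep_vars_def2 indep_sets_def)
next
  case False
  then show ?thesis
    using assms
    by (intro indep_vars_finite[where E = "\<lambda>i. sets (M' i)", THEN iffD2])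
       (auto simp: Pi_iff sets.Int_stable sets.sigma_sets_eq dest: sets.sets_into_space)
qed

locale localized_space =
  fixes M :: "'a measure" and Bs :: "nat \<Rightarrow> 'a set"
  assumes localizing: "localizing_seq M Bs"
begin

abbreviation \<N> where "\<N> \<equiv> counting_algebra M Bs"

lemma sets_Bs [measurable, simp]: "Bs n \<in> sets M"
  and incseq_Bs: "incseq Bs"
  and UN_Bs: "(\<Union>n. Bs n) = space M"
  using localizing by (auto simp: localizing_seq_def)

lemma bounded_sets_iff: "B \<in> bounded_sets M Bs \<longleftrightarrow> B \<in> sets M \<and> (\<exists>n. B \<subseteq> Bs n)"
  unfolding bounded_sets_def by (auto intro: exI[of _ B] simp: Int_absorb2)

lemma counting_measuresI:
  assumes "sets \<mu> = sets M"
    and "\<And>B n. B \<in> sets M \<Longrightarrow> B \<subseteq> Bs n \<Longrightarrow> \<exists>k::nat. emeasure \<mu> B = of_nat k"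
  shows "\<mu> \<in> space \<N>"
  using assms by (auto simp: space_counting_algebra counting_measures_def bounded_sets_iff)

lemma sets_counting: "\<mu> \<in> space \<N> \<Longrightarrow> sets \<mu> = sets M"
  by (auto simp: space_counting_algebra counting_measures_def)

lemma space_counting: "\<mu> \<in> space \<N> \<Longrightarrow> space \<mu> = space M"
  by (rule sets_eq_imp_space_eq) (rule sets_counting)

lemma counting_bounded:
  "\<mu> \<in> space \<N> \<Longrightarrow> B \<in> sets M \<Longrightarrow> B \<subseteq> Bs n \<Longrightarrow> \<exists>k::nat. emeasure \<mu> B = of_nat k"
  by (auto simp: space_counting_algebra counting_measures_def bounded_sets_iff)

lemma emeasure_restr_counting:
  "\<mu> \<in> space \<N> \<Longrightarrow> B \<in> sets M \<Longrightarrow> A \<in> sets M \<Longrightarrow> emeasure (restr \<mu> B) A = emeasure \<mu> (A \<inter> B)"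
  by (simp add: emeasure_restr sets_counting)

lemma emeasure_add_counting:
  "\<mu> \<in> space \<N> \<Longrightarrow> \<psi> \<in> space \<N> \<Longrightarrow> A \<in> sets M \<Longrightarrow>
    emeasure (add_measure \<mu> \<psi>) A = emeasure \<mu> A + emeasure \<psi> A"
  by (simp add: emeasure_add_measure sets_counting)

lemma restr_counting [simp]:
  assumes "\<mu> \<in> space \<N>" "B \<in> sets M" shows "restr \<mu> B \<in> space \<N>"
  using assms
  by (intro counting_measuresI)
     (auto simp: sets_counting emeasure_restr_counting intro!: counting_bounded)

lemma add_counting [simp]:
  assumes "\<mu> \<in> space \<N>" "\<psi> \<in> space \<N>" shows "add_measure \<mu> \<psi> \<in> space \<N>"
proof (intro counting_measuresI)
  fix B n assume "B \<in> sets M" "B \<subseteq> Bs n"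
  then obtain k l :: nat where "emeasure \<mu> B = of_nat k" "emeasure \<psi> B = of_nat l"
    using assms counting_bounded by metis
  then show "\<exists>k::nat. emeasure (add_measure \<mu> \<psi>) B = of_nat k"
    using assms \<open>B \<in> sets M\<close> by (intro exI[of _ "k + l"]) (simp add: emeasure_add_counting)
qed (simp add: assms sets_counting)

lemma return_counting [simp]: "x \<in> space M \<Longrightarrow> return M x \<in> space \<N>"
  by (rule counting_measuresI) (auto simp: indicator_def intro: exI[of _ "0::nat"] exI[of _ "1::nat"])

lemma null_counting [simp]: "null_measure M \<in> space \<N>"
  by (rule counting_measuresI) (auto intro: exI[of _ "0::nat"])

lemma counting_eqI:
  "\<mu> \<in> space \<N> \<Longrightarrow> \<psi> \<in> space \<N> \<Longrightarrow> (\<And>C. C \<in> sets M \<Longrightarrow> emeasure \<mu> C = emeasure \<psi> C) \<Longrightarrow> \<mu> = \<psi>"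
  by (rule measure_eqI) (auto simp: sets_counting)

lemma measurable_counting_algebraI:
  assumes "\<And>x. x \<in> space X \<Longrightarrow> f x \<in> space \<N>"
    and "\<And>C. C \<in> sets M \<Longrightarrow> (\<lambda>x. emeasure (f x) C) \<in> borel_measurable X"
  shows "f \<in> measurable X \<N>"
  unfolding counting_algebra_def
proof (rule measurable_Sup2)
  fix m assume "m \<in> (\<lambda>B. vimage_algebra (counting_measures M Bs) (\<lambda>\<mu>. emeasure \<mu> B) borel) ` sets M"
  then show "f \<in> measurable X m"
    using assms by (auto intro!: measurable_vimage_algebra2 simp: space_counting_algebra)
qed auto

lemma measurable_emeasure_counting [measurable]:
  "f \<in> measurable X \<N> \<Longrightarrow> C \<in> sets M \<Longrightarrow> (\<lambda>x. emeasure (f x) C) \<in> borel_measurable X"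
  by (rule measurable_compose[OF _ measurable_emeasure_counting_algebra])

text \<open>Cutting down to \<open>Bs n\<close> is how finiteness enters the measure-theoretic
  inductions; this identity removes the cut again.\<close>

lemma SUP_emeasure_Bs:
  assumes "sets \<mu> = sets M" "A \<in> sets M"
  shows "(SUP n. emeasure \<mu> (A \<inter> Bs n)) = emeasure \<mu> A"
proof -
  have "(SUP n. emeasure \<mu> (A \<inter> Bs n)) = emeasure \<mu> (\<Union>n. A \<inter> Bs n)"
    using assms incseqD[OF incseq_Bs]
    by (intro SUP_emeasure_incseq) (fastforce simp: incseq_def image_subset_iff)+
  also have "(\<Union>n. A \<inter> Bs n) = A"
    using sets.sets_into_space[OF assms(2)] UN_Bs by auto
  finally show ?thesis .
qed

section \<open>Measurable dependence of counting measures on a parameter\<close>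

lemma measurable_add_measure [measurable]:
  assumes [measurable]: "f \<in> measurable X \<N>" "g \<in> measurable X \<N>"
  shows "(\<lambda>x. add_measure (f x) (g x)) \<in> measurable X \<N>"
proof (rule measurable_counting_algebraI)
  fix C assume [measurable]: "C \<in> sets M"
  have "(\<lambda>x. emeasure (f x) C + emeasure (g x) C) \<in> borel_measurable X" by measurable
  then show "(\<lambda>x. emeasure (add_measure (f x) (g x)) C) \<in> borel_measurable X"
    by (rule measurable_cong[THEN iffD1, rotated])
       (auto simp: emeasure_add_counting measurable_space[OF assms(1)] measurable_space[OF assms(2)])
qed (auto intro!: add_counting measurable_space[OF assms(1)] measurable_space[OF assms(2)])

lemma measurable_return_counting [measurable]: "return M \<in> measurable M \<N>"
  by (rule measurable_counting_algebraI) auto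

text \<open>Dynkin argument over measurable rectangles. Closure under complements subtracts masses,
  which may be infinite on the whole space, so the sections are first cut down to
  \<open>Bs n\<close>, where masses are natural numbers, and \<open>n\<close> is then sent to
  infinity.\<close>

lemma measurable_kernel_emeasure:
  assumes f [measurable]: "f \<in> measurable X \<N>"
    and W: "W \<in> sets (M \<Otimes>\<^sub>M X)"
  shows "(\<lambda>x. emeasure (f x) {y \<in> space M. (y, x) \<in> W}) \<in> borel_measurable X"
proof -
  have sp: "f x \<in> space \<N>" if "x \<in> space X" for x
    using measurable_space[OF f that] .
  have cut: "{y \<in> space M. (y, x) \<in> V} \<in> sets M" if "V \<in> sets (M \<Otimes>\<^sub>M X)" "x \<in> space X" for V x
    using sets_Pair2[OF that(1), of x] sets.sets_into_space[OF that(1)] that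
    by (auto simp: vimage_def space_pair_measure elim!: back_subst[where P="\<lambda>A. A \<in> sets M"])
  have *: "(\<lambda>x. emeasure (f x) ({y \<in> space M. (y, x) \<in> W} \<inter> Bs n)) \<in> borel_measurable X" for n
    using Int_stable_pair_measure_generator pair_measure_closed W
    unfolding sets_pair_measure
  proof (induct rule: sigma_sets_induct_disjoint)
    case (basic A)
    then obtain C D where A: "A = C \<times> D" and [measurable]: "C \<in> sets M" "D \<in> sets X" by auto
    have "(\<lambda>x. emeasure (f x) (C \<inter> Bs n) * indicator D x) \<in> borel_measurable X" by measurable
    moreover have "{y \<in> space M. (y, x) \<in> A} = (if x \<in> D then C else {})" for x
      using sets.sets_into_space[OF \<open>C \<in> sets M\<close>] by (auto simp: A)
    ultimately show ?case
      by (simp add: if_distrib[of "\<lambda>A. emeasure (f _) (A \<inter> _)"] indicator_def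
        if_distrib[of "\<lambda>x. _ * x"] cong: if_cong)
  next
    case (compl A)
    then have A: "A \<in> sets (M \<Otimes>\<^sub>M X)" by (simp add: sets_pair_measure)
    have "emeasure (f x) ({y \<in> space M. (y, x) \<in> space M \<times> space X - A} \<inter> Bs n) =
        emeasure (f x) (Bs n) - emeasure (f x) ({y \<in> space M. (y, x) \<in> A} \<inter> Bs n)"
      if x: "x \<in> space X" for x
    proof -
      obtain k :: nat where k: "emeasure (f x) ({y \<in> space M. (y, x) \<in> A} \<inter> Bs n) = of_nat k"
        using counting_bounded[OF sp[OF x], of "{y \<in> space M. (y, x) \<in> A} \<inter> Bs n" n] cut[OF A x] by auto
      have "{y \<in> space M. (y, x) \<in> space M \<times> space X - A} \<inter> Bs n
          = Bs n - {y \<in> space M. (y, x) \<in> A} \<inter> Bs n"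
        using x sets.sets_into_space[OF sets_Bs[of n]] by auto
      then show ?thesis
        using cut[OF A x] k
        by (simp add: emeasure_Diff sets_counting[OF sp[OF x]])
    qed
    with compl show ?case
      by (subst measurable_cong[where g = "\<lambda>x. emeasure (f x) (Bs n)
        - emeasure (f x) ({y \<in> space M. (y, x) \<in> A} \<inter> Bs n)"]) auto
  next
    case (union F)
    then have F: "F i \<in> sets (M \<Otimes>\<^sub>M X)" for i by (auto simp: sets_pair_measure)
    have "emeasure (f x) ({y \<in> space M. (y, x) \<in> \<Union> (range F)} \<inter> Bs n) =
        (\<Sum>i. emeasure (f x) ({y \<in> space M. (y, x) \<in> F i} \<inter> Bs n))" if x: "x \<in> space X" for x
    proof -
      have "{y \<in> space M. (y, x) \<in> \<Union> (range F)} \<inter> Bs n = (\<Union>i. {y \<in> space M. (y, x) \<in> F i} \<inter> Bs n)"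
        by auto
      also have "emeasure (f x) \<dots> = (\<Sum>i. emeasure (f x) ({y \<in> space M. (y, x) \<in> F i} \<inter> Bs n))"
        using cut[OF F x] union(1)
        by (intro suminf_emeasure[symmetric])
           (auto simp: sets_counting[OF sp[OF x]] disjoint_family_on_def)
      finally show ?thesis .
    qed
    with union show ?case
      by (subst measurable_cong[where g = "\<lambda>x. \<Sum>i. emeasure (f x) ({y \<in> space M. (y, x) \<in> F i} \<inter> Bs n)"]) auto
  qed simp
  have "(\<lambda>x. SUP n. emeasure (f x) ({y \<in> space M. (y, x) \<in> W} \<inter> Bs n)) \<in> borel_measurable X"
    using * by measurable
  then show ?thesis
    by (rule measurable_cong[THEN iffD1, rotated])
       (intro SUP_emeasure_Bs sets_counting sp cut W)
qed

text \<open>Needed for inner integrals against the random measure itself, as on the left of the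
  Mecke equation.\<close>

lemma measurable_kernel_nn_integral:
  fixes h :: "'a \<times> 'b \<Rightarrow> ennreal"
  assumes f [measurable]: "f \<in> measurable X \<N>"
    and h: "h \<in> borel_measurable (M \<Otimes>\<^sub>M X)"
  shows "(\<lambda>x. \<integral>\<^sup>+y. h (y, x) \<partial>f x) \<in> borel_measurable X"
proof -
  have sp: "f x \<in> space \<N>" if "x \<in> space X" for x
    using measurable_space[OF f that] .
  have m: "(\<lambda>y. g (y, x)) \<in> borel_measurable (f x)"
    if "g \<in> borel_measurable (M \<Otimes>\<^sub>M X)" "x \<in> space X" for g :: "'a \<times> 'b \<Rightarrow> ennreal" and x
    using that by (simp add: measurable_cong_sets[OF sets_counting[OF sp] refl])
  show ?thesis
    using h
  proof (induct rule: borel_measurable_induct)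
    case (cong g h)
    have "(\<integral>\<^sup>+y. g (y, x) \<partial>f x) = (\<integral>\<^sup>+y. h (y, x) \<partial>f x)" if "x \<in> space X" for x
      using cong that by (intro nn_integral_cong) (auto simp: space_counting[OF sp] space_pair_measure)
    with cong show ?case by (simp cong: measurable_cong)
  next
    case (set A)
    have "(\<integral>\<^sup>+y. indicator A (y, x) \<partial>f x) = emeasure (f x) {y \<in> space M. (y, x) \<in> A}"
      if "x \<in> space X" for x
    proof -
      have "{y \<in> space M. (y, x) \<in> A} \<in> sets (f x)"
        using set that unfolding sets_counting[OF sp[OF that]] by measurable
      then have "emeasure (f x) {y \<in> space M. (y, x) \<in> A} =
          (\<integral>\<^sup>+y. indicator {y \<in> space M. (y, x) \<in> A} y \<partial>f x)" by simp
      also have "\<dots> = (\<integral>\<^sup>+y. indicator A (y, x) \<partial>f x)"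
        by (intro nn_integral_cong) (auto simp: space_counting[OF sp[OF that]] split: split_indicator)
      finally show ?thesis ..
    qed
    with measurable_kernel_emeasure[OF f set] show ?case by (simp cong: measurable_cong)
  next
    case (mult u c)
    then show ?case by (simp add: nn_integral_cmult m cong: measurable_cong)
  next
    case (add u v)
    then show ?case by (simp add: nn_integral_add m cong: measurable_cong)
  next
    case (seq U)
    have "(\<integral>\<^sup>+y. (SUP i. U i) (y, x) \<partial>f x) = (SUP i. \<integral>\<^sup>+y. U i (y, x) \<partial>f x)"
      if "x \<in> space X" for x
      unfolding SUP_apply using seq that
      by (intro nn_integral_monotone_convergence_SUP m) (auto simp: incseq_def le_fun_def)
    with seq show ?case by (simp cong: measurable_cong)
  qed
qed

text \<open>The mass of \<open>C\<close> under the restriction is the mass of the section at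
  \<open>x\<close> of one fixed measurable set, the graph of \<open>D\<close> cut down to
  \<open>C\<close>; so the region may depend on the same parameter as the measure.\<close>

lemma measurable_restr:
  assumes f [measurable]: "f \<in> measurable X \<N>"
    and W: "{z \<in> space (M \<Otimes>\<^sub>M X). fst z \<in> D (snd z)} \<in> sets (M \<Otimes>\<^sub>M X)"
    and D: "\<And>x. x \<in> space X \<Longrightarrow> D x \<in> sets M"
  shows "(\<lambda>x. restr (f x) (D x)) \<in> measurable X \<N>"
proof (rule measurable_counting_algebraI)
  fix C assume C [measurable]: "C \<in> sets M"
  have sp: "f x \<in> space \<N>" if "x \<in> space X" for x
    using measurable_space[OF f that] .
  let ?W = "{z \<in> space (M \<Otimes>\<^sub>M X). fst z \<in> D (snd z)} \<inter> C \<times> space X"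
  have "?W \<in> sets (M \<Otimes>\<^sub>M X)" using W by measurable
  then have "(\<lambda>x. emeasure (f x) {y \<in> space M. (y, x) \<in> ?W}) \<in> borel_measurable X"
    by (rule measurable_kernel_emeasure[OF f])
  moreover have "{y \<in> space M. (y, x) \<in> ?W} = C \<inter> D x" if "x \<in> space X" for x
    using that sets.sets_into_space[OF C] by (auto simp: space_pair_measure)
  ultimately show "(\<lambda>x. emeasure (restr (f x) (D x)) C) \<in> borel_measurable X"
    using D by (auto simp: emeasure_restr_counting sp cong: measurable_cong)
qed (auto intro!: restr_counting D measurable_space[OF f])

lemma measurable_restr_const [measurable]:
  assumes f [measurable]: "f \<in> measurable X \<N>" and [measurable]: "C \<in> sets M"
  shows "(\<lambda>x. restr (f x) C) \<in> measurable X \<N>"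
  by (rule measurable_restr) auto

end

section \<open>Cylinder sets and independence of counts\<close>

context localized_space
begin

text \<open>Finite-dimensional events. The target sets lie in the extended nonnegative reals because
  counts of unbounded sets may be infinite; the sets \<open>C i\<close> may overlap or repeat, so
  that intersecting two cylinders amounts to concatenation.\<close>

definition cylinder :: "nat \<Rightarrow> (nat \<Rightarrow> 'a set) \<Rightarrow> (nat \<Rightarrow> ennreal set) \<Rightarrow> 'a measure set" where
  "cylinder m C S = {\<mu> \<in> space \<N>. \<forall>i<m. emeasure \<mu> (C i) \<in> S i}"

definition cylinders :: "'a measure set set" where
  "cylinders = {cylinder m C S | m C S. (\<forall>i<m. C i \<in> sets M) \<and> (\<forall>i<m. S i \<in> sets borel)}"

lemma cylinder_sets [measurable]:
  assumes "\<And>i. i < m \<Longrightarrow> C i \<in> sets M" "\<And>i. i < m \<Longrightarrow> S i \<in> sets borel"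
  shows "cylinder m C S \<in> sets \<N>"
proof -
  have "{\<mu> \<in> space \<N>. emeasure \<mu> (C i) \<in> S i} \<in> sets \<N>" if "i < m" for i
    using measurable_sets[OF measurable_emeasure_counting_algebra[OF assms(1)[OF that]] assms(2)[OF that]]
    by (simp add: vimage_def Int_def conj_commute)
  then have "{\<mu> \<in> space \<N>. \<forall>i\<in>{..<m}. emeasure \<mu> (C i) \<in> S i} \<in> sets \<N>"
    by (intro sets.sets_Collect_finite_All) auto
  then show ?thesis by (simp only: cylinder_def Ball_def lessThan_iff)
qed

lemma Int_stable_cylinders: "Int_stable cylinders"
proof (rule Int_stableI)
  fix A B assume "A \<in> cylinders" "B \<in> cylinders"
  then obtain m C S m' C' S' where A: "A = cylinder m C S" and B: "B = cylinder m' C' S'"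
    and *: "\<forall>i<m. C i \<in> sets M" "\<forall>i<m. S i \<in> sets borel"
      "\<forall>i<m'. C' i \<in> sets M" "\<forall>i<m'. S' i \<in> sets borel"
    by (auto simp: cylinders_def)
  \<comment> \<open>The second family is appended to the first, with its index shifted by
    \<open>m\<close>.\<close>
  let ?C = "\<lambda>i. if i < m then C i else C' (i - m)" and ?S = "\<lambda>i. if i < m then S i else S' (i - m)"
  have "(\<forall>i<m + m'. Q i (if i < m then C i else C' (i - m)) (if i < m then S i else S' (i - m)))
      \<longleftrightarrow> (\<forall>i<m. Q i (C i) (S i)) \<and> (\<forall>i<m'. Q (i + m) (C' i) (S' i))" for Q :: "nat \<Rightarrow> 'a set \<Rightarrow> ennreal set \<Rightarrow> bool"
    apply safe
    subgoal for i by (drule spec[of _ i]) auto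
    subgoal for i by (drule spec[of _ "i + m"]) auto
    subgoal for i by (cases "i < m") (auto dest!: spec[of _ "i - m"])
    done
  note split = this
  have "A \<inter> B = cylinder (m + m') ?C ?S"
    unfolding A B cylinder_def using split[of "\<lambda>_ C S. emeasure _ C \<in> S"] by blast
  then show "A \<inter> B \<in> cylinders"
    unfolding cylinders_def using * by (intro CollectI exI[of _ "m + m'"] exI[of _ ?C] exI[of _ ?S]) auto
qed

text \<open>Cylinders of length one already generate; the longer ones are there to make the
  generator intersection-stable.\<close>

lemma sets_counting_algebra_cylinders: "sets \<N> = sigma_sets (space \<N>) cylinders"
proof
  have "sets \<N> = sigma_sets (space \<N>) (\<Union>B\<in>sets M.
      sets (vimage_algebra (counting_measures M Bs) (\<lambda>\<mu>. emeasure \<mu> B) borel))"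
    unfolding space_counting_algebra
    using sets_Sup_eq[of "(\<lambda>B. vimage_algebra (counting_measures M Bs) (\<lambda>\<mu>. emeasure \<mu> B) borel) ` sets M"
       "counting_measures M Bs"] sets.empty_sets[of M]
    by (force simp: counting_algebra_def simp del: sets.empty_sets)
  also have "\<dots> \<subseteq> sigma_sets (space \<N>) cylinders"
  proof (intro sigma_sets_mono subsetI)
    fix A assume "A \<in> (\<Union>B\<in>sets M. sets (vimage_algebra (counting_measures M Bs) (\<lambda>\<mu>. emeasure \<mu> B) borel))"
    then obtain B S where "B \<in> sets M" "S \<in> sets borel"
      "A = (\<lambda>\<mu>. emeasure \<mu> B) -` S \<inter> counting_measures M Bs"
      by (auto simp: sets_vimage_algebra2)
    then have "A = cylinder 1 (\<lambda>_. B) (\<lambda>_. S)" by (auto simp: cylinder_def space_counting_algebra)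
    then show "A \<in> sigma_sets (space \<N>) cylinders"
      using \<open>B \<in> sets M\<close> \<open>S \<in> sets borel\<close> by (auto simp: cylinders_def intro!: sigma_sets.Basic)
  qed
  finally show "sets \<N> \<subseteq> sigma_sets (space \<N>) cylinders" .
  show "sigma_sets (space \<N>) cylinders \<subseteq> sets \<N>"
    by (rule sets.sigma_sets_subset) (auto simp: cylinders_def intro!: cylinder_sets)
qed

lemma space_in_cylinders: "space \<N> \<in> cylinders"
  unfolding cylinders_def by (intro CollectI exI[of _ "0::nat"]) (auto simp: cylinder_def)

end

locale poisson = localized_space M Bs
  for M :: "'a measure" and Bs :: "nat \<Rightarrow> 'a set" +
  fixes \<Lambda> :: "'a measure" and P :: "'w measure" and \<eta> :: "'w \<Rightarrow> 'a measure"
  assumes lf: "locally_finite M Bs \<Lambda>" and pp: "poisson_process M Bs \<Lambda> P \<eta>"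
begin

sublocale prob_space P
  using pp by (simp add: poisson_process_def)

lemma eta_measurable [measurable]: "\<eta> \<in> measurable P \<N>"
  using pp by (simp add: poisson_process_def)

lemma eta_counting [simp]: "\<omega> \<in> space P \<Longrightarrow> \<eta> \<omega> \<in> space \<N>"
  using measurable_space[OF eta_measurable] .

lemma sets_Lambda [measurable_cong, simp]: "sets \<Lambda> = sets M"
  using lf by (simp add: locally_finite_def)

lemma space_Lambda [simp]: "space \<Lambda> = space M"
  by (rule sets_eq_imp_space_eq) simp

lemma Lambda_bounded: "B \<in> sets M \<Longrightarrow> B \<subseteq> Bs n \<Longrightarrow> emeasure \<Lambda> B < \<infinity>"
  using lf by (auto simp: locally_finite_def bounded_sets_iff)

sublocale \<Lambda>: sigma_finite_measure \<Lambda>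
proof
  show "\<exists>A. countable A \<and> A \<subseteq> sets \<Lambda> \<and> \<Union>A = space \<Lambda> \<and> (\<forall>a\<in>A. emeasure \<Lambda> a \<noteq> \<infinity>)"
    using UN_Bs Lambda_bounded[OF sets_Bs order_refl]
    by (intro exI[of _ "range Bs"]) (auto simp: less_top)
qed

text \<open>The definition of a Poisson process gives independence only along initial segments of
  the naturals; enumerating \<open>J\<close> transports it to any finite index set, for instance one
  made of sets of indices.\<close>

lemma indep_counts:
  assumes "finite J" "disjoint_family_on C J" "\<And>i. i \<in> J \<Longrightarrow> C i \<in> sets M"
  shows "indep_vars (\<lambda>_. borel) (\<lambda>i \<omega>. emeasure (\<eta> \<omega>) (C i)) J"
proof -
  obtain h where h: "bij_betw h {0..<card J} J" using ex_bij_betw_nat_finite[OF assms(1)] by auto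
  then have inj: "inj_on h {..<card J}" and img: "h ` {..<card J} = J"
    by (auto simp: bij_betw_def atLeast0LessThan)
  have "disjoint_family_on (\<lambda>i. C (h i)) {..<card J}"
    unfolding disjoint_family_on_def
  proof (intro ballI impI)
    fix i j assume "i \<in> {..<card J}" "j \<in> {..<card J}" "i \<noteq> j"
    then show "C (h i) \<inter> C (h j) = {}"
      using assms(2) inj img by (intro disjoint_family_onD[OF assms(2)]) (auto simp: inj_on_def)
  qed
  moreover have "\<forall>i<card J. C (h i) \<in> sets M" using img assms(3) by auto
  ultimately have ind: "indep_vars (\<lambda>_. borel) (\<lambda>i \<omega>. emeasure (\<eta> \<omega>) (C (h i))) {..<card J}"
    using pp by (auto simp: poisson_process_def)
  have "prob (\<Inter>i\<in>J. (\<lambda>\<omega>. emeasure (\<eta> \<omega>) (C i)) -` A i \<inter> space P)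
      = (\<Prod>i\<in>J. prob ((\<lambda>\<omega>. emeasure (\<eta> \<omega>) (C i)) -` A i \<inter> space P))"
    if A: "\<And>i. i \<in> J \<Longrightarrow> A i \<in> sets borel" and ne: "J \<noteq> {}" for A
  proof -
    let ?F = "\<lambda>i. (\<lambda>\<omega>. emeasure (\<eta> \<omega>) (C i)) -` A i \<inter> space P"
    have "prob (\<Inter>i\<in>{..<card J}. ?F (h i)) = (\<Prod>i<card J. prob (?F (h i)))"
      using A img ne assms(1) by (intro indep_varsD_finite[OF ind]) (auto simp: card_gt_0_iff)
    moreover have "?F ` J = (\<lambda>i. ?F (h i)) ` {..<card J}"
      using image_image[of ?F h "{..<card J}"] unfolding img .
    ultimately show ?thesis
      using prod.reindex_bij_betw[OF h, of "\<lambda>i. prob (?F i)"] by (simp add: atLeast0LessThan)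
  qed
  then show ?thesis
    using assms by (intro indep_vars_finiteI) auto
qed

text \<open>The \<open>E j\<close> may overlap, so independence does not apply to them directly.
  They are split into the atoms of the finite partition they generate outside \<open>D\<close>; the
  atoms together with \<open>D\<close> are disjoint, and each count of an \<open>E j\<close> is a
  finite sum of atom counts.\<close>

lemma indep_count_rest:
  fixes m :: nat
  assumes D [measurable]: "D \<in> sets M"
    and E [measurable]: "\<And>j. j < m \<Longrightarrow> E j \<in> sets M"
    and disj: "\<And>j. j < m \<Longrightarrow> E j \<inter> D = {}"
  shows "distr P (borel \<Otimes>\<^sub>M (\<Pi>\<^sub>M j\<in>{..<m}. borel))
      (\<lambda>\<omega>. (emeasure (\<eta> \<omega>) D, \<lambda>j\<in>{..<m}. emeasure (\<eta> \<omega>) (E j))) =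
    distr P borel (\<lambda>\<omega>. emeasure (\<eta> \<omega>) D) \<Otimes>\<^sub>M
    distr P (\<Pi>\<^sub>M j\<in>{..<m}. borel) (\<lambda>\<omega>. \<lambda>j\<in>{..<m}. emeasure (\<eta> \<omega>) (E j))"
proof -
  \<comment> \<open>\<open>I\<close> is the set of indices \<open>j\<close> whose \<open>E j\<close>
    contains the point. In the family \<open>C\<close>, the index \<open>None\<close> stands for
    \<open>D\<close> and \<open>Some I\<close> for an atom.\<close>
  define atom where "atom I = {x \<in> space M. x \<notin> D \<and> (\<forall>j\<in>{..<m}. x \<in> E j \<longleftrightarrow> j \<in> I)}" for I
  define C where "C = case_option D atom"
  define K where "K = Some ` Pow {..<m}"
  define X where "X i \<omega> = emeasure (\<eta> \<omega>) (C i)" for i \<omega>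
  have fin: "finite K" by (simp add: K_def)
  have atom [measurable]: "atom I \<in> sets M" for I
    unfolding atom_def by measurable
  have "C i \<in> sets M" for i by (cases i) (auto simp: C_def)
  moreover have "disjoint_family_on C (insert None K)"
    by (auto simp: disjoint_family_on_def C_def K_def atom_def)
  ultimately have ind: "indep_vars (\<lambda>_. borel) X (insert None K)"
    unfolding X_def using fin by (intro indep_counts) auto
  let ?Y = "\<lambda>v. v None :: ennreal"
  \<comment> \<open>The counts of the \<open>E j\<close> as a measurable function of the atom counts
    alone, each being the sum over the atoms inside it.\<close>
  let ?V = "\<lambda>v. \<lambda>j\<in>{..<m}. \<Sum>I | I \<subseteq> {..<m} \<and> j \<in> I. v (Some I) :: ennreal"
  let ?R = "\<lambda>K \<omega>. restrict (\<lambda>i. X i \<omega>) K"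
  let ?B = "\<lambda>K. \<Pi>\<^sub>M i\<in>K. borel :: ennreal measure"
  have ind': "indep_var (?B {None}) (?R {None}) (?B K) (?R K)"
    by (rule indep_var_restrict[OF ind]) (auto simp: K_def)
  have [measurable]: "?R {None} \<in> measurable P (?B {None})" "?R K \<in> measurable P (?B K)"
    using ind' unfolding indep_var_distribution_eq by auto
  have [measurable]: "?Y \<in> measurable (?B {None}) borel"
    by (rule measurable_component_singleton) simp
  have [measurable]: "?V \<in> measurable (?B K) (?B {..<m})"
    by (intro measurable_restrict borel_measurable_sum measurable_component_singleton) (auto simp: K_def)
  interpret R: prob_space "distr P (?B K) (?R K)" by (rule prob_space_distr) simp
  interpret V: prob_space "distr (distr P (?B K) (?R K)) (?B {..<m}) ?V" by (rule R.prob_space_distr) simp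
  have *: "distr P borel (?Y \<circ> ?R {None}) \<Otimes>\<^sub>M distr P (?B {..<m}) (?V \<circ> ?R K) =
      distr P (borel \<Otimes>\<^sub>M ?B {..<m}) (\<lambda>\<omega>. ((?Y \<circ> ?R {None}) \<omega>, (?V \<circ> ?R K) \<omega>))"
  proof -
    have "distr P borel (?Y \<circ> ?R {None}) \<Otimes>\<^sub>M distr P (?B {..<m}) (?V \<circ> ?R K) =
        distr (distr P (?B {None}) (?R {None})) borel ?Y \<Otimes>\<^sub>M distr (distr P (?B K) (?R K)) (?B {..<m}) ?V"
      by (simp add: distr_distr)
    also have "\<dots> = distr (distr P (?B {None}) (?R {None}) \<Otimes>\<^sub>M distr P (?B K) (?R K))
        (borel \<Otimes>\<^sub>M ?B {..<m}) (\<lambda>(x, y). (?Y x, ?V y))"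
      by (rule pair_measure_distr) (auto intro: V.sigma_finite_measure_axioms)
    also have "\<dots> = distr (distr P (?B {None} \<Otimes>\<^sub>M ?B K) (\<lambda>\<omega>. (?R {None} \<omega>, ?R K \<omega>)))
        (borel \<Otimes>\<^sub>M ?B {..<m}) (\<lambda>(x, y). (?Y x, ?V y))"
      using ind' unfolding indep_var_distribution_eq by simp
    also have "\<dots> = distr P (borel \<Otimes>\<^sub>M ?B {..<m}) (\<lambda>\<omega>. ((?Y \<circ> ?R {None}) \<omega>, (?V \<circ> ?R K) \<omega>))"
      by (subst distr_distr) (auto simp: comp_def)
    finally show ?thesis .
  qed
  have Y: "(?Y \<circ> ?R {None}) \<omega> = emeasure (\<eta> \<omega>) D" for \<omega>
    by (simp add: X_def C_def)
  have V: "(?V \<circ> ?R K) \<omega> = (\<lambda>j\<in>{..<m}. emeasure (\<eta> \<omega>) (E j))"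
    if "\<omega> \<in> space P" for \<omega>
  proof -
    have "(\<Sum>I | I \<subseteq> {..<m} \<and> j \<in> I. restrict (\<lambda>i. X i \<omega>) K (Some I)) = emeasure (\<eta> \<omega>) (E j)"
      if j: "j < m" for j
    proof -
      have "(\<Sum>I | I \<subseteq> {..<m} \<and> j \<in> I. restrict (\<lambda>i. X i \<omega>) K (Some I))
          = (\<Sum>I | I \<subseteq> {..<m} \<and> j \<in> I. emeasure (\<eta> \<omega>) (atom I))"
        by (intro sum.cong) (auto simp: X_def K_def C_def)
      also have "\<dots> = emeasure (\<eta> \<omega>) (\<Union>I\<in>{I. I \<subseteq> {..<m} \<and> j \<in> I}. atom I)"
      proof (rule sum_emeasure)
        show "atom ` {I. I \<subseteq> {..<m} \<and> j \<in> I} \<subseteq> sets (\<eta> \<omega>)"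
          using atom sets_counting[OF eta_counting[OF \<open>\<omega> \<in> space P\<close>]] by auto
        show "disjoint_family_on atom {I. I \<subseteq> {..<m} \<and> j \<in> I}"
          by (auto simp: disjoint_family_on_def atom_def)
      qed simp
      also have "(\<Union>I\<in>{I. I \<subseteq> {..<m} \<and> j \<in> I}. atom I) = E j"
      proof (intro set_eqI iffI)
        fix x assume x: "x \<in> E j"
        with j sets.sets_into_space[OF E[OF j]] disj[OF j]
        have "x \<in> atom {i\<in>{..<m}. x \<in> E i}" by (auto simp: atom_def)
        then show "x \<in> (\<Union>I\<in>{I. I \<subseteq> {..<m} \<and> j \<in> I}. atom I)"
          using x j by (intro UN_I[of "{i\<in>{..<m}. x \<in> E i}"]) auto
      qed (use j in \<open>auto simp: atom_def\<close>)
      finally show ?thesis .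
    qed
    then show ?thesis by (auto simp: fun_eq_iff)
  qed
  have "distr P borel (?Y \<circ> ?R {None}) = distr P borel (\<lambda>\<omega>. emeasure (\<eta> \<omega>) D)"
    "distr P (?B {..<m}) (?V \<circ> ?R K) = distr P (?B {..<m}) (\<lambda>\<omega>. \<lambda>j\<in>{..<m}. emeasure (\<eta> \<omega>) (E j))"
    "distr P (borel \<Otimes>\<^sub>M ?B {..<m}) (\<lambda>\<omega>. ((?Y \<circ> ?R {None}) \<omega>, (?V \<circ> ?R K) \<omega>)) =
      distr P (borel \<Otimes>\<^sub>M ?B {..<m}) (\<lambda>\<omega>. (emeasure (\<eta> \<omega>) D, \<lambda>j\<in>{..<m}. emeasure (\<eta> \<omega>) (E j)))"
    by (intro distr_cong refl, simp only: Y V)+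
  with * show ?thesis by simp
qed

end

section \<open>The Mecke equation\<close>

context localized_space
begin

abbreviation add_point :: "'a measure \<Rightarrow> 'a \<Rightarrow> 'a measure" where
  "add_point \<mu> x \<equiv> add_measure \<mu> (return M x)"

lemma emeasure_add_point:
  "\<mu> \<in> space \<N> \<Longrightarrow> x \<in> space M \<Longrightarrow> C \<in> sets M \<Longrightarrow>
    emeasure (add_point \<mu> x) C = emeasure \<mu> C + indicator C x"
  by (simp add: emeasure_add_counting)

lemma measurable_add_point [measurable]:
  assumes [measurable]: "f \<in> measurable X \<N>" and g: "g \<in> measurable X M"
  shows "(\<lambda>x. add_point (f x) (g x)) \<in> measurable X \<N>"
  by (rule measurable_add_measure[OF assms(1) measurable_compose[OF g measurable_return_counting]])

lemma indicator_cylinder: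
  "\<mu> \<in> space \<N> \<Longrightarrow>
    indicator (cylinder m C S) \<mu> = (\<Prod>i<m. indicator (S i) (emeasure \<mu> (C i)) :: ennreal)"
  by (cases "\<forall>i<m. emeasure \<mu> (C i) \<in> S i") (auto simp: cylinder_def indicator_def)

end

context poisson
begin

section \<open>Poisson counts and the Mecke equation on cylinders\<close>

lemma poisson_count:
  "C \<in> sets M \<Longrightarrow> emeasure \<Lambda> C < \<infinity> \<Longrightarrow>
    prob {\<omega> \<in> space P. emeasure (\<eta> \<omega>) C = of_nat k}
      = measure \<Lambda> C ^ k / fact k * exp (- measure \<Lambda> C)"
  using pp unfolding poisson_process_def
  by (auto simp: poisson_distributed_def measure_def[of \<Lambda>] dest!: bspec[of _ _ C])

text \<open>\<open>C\<close> has finite intensity but may be unbounded, so its count need not be a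
  natural number everywhere. Since the Poisson weights sum to one, it is a natural number almost
  surely, and the integral becomes a series.\<close>

lemma nn_integral_count:
  fixes h :: "ennreal \<Rightarrow> ennreal"
  assumes C [measurable]: "C \<in> sets M" and fin: "emeasure \<Lambda> C < \<infinity>"
    and h [measurable]: "h \<in> borel_measurable borel"
  shows "(\<integral>\<^sup>+\<omega>. h (emeasure (\<eta> \<omega>) C) \<partial>P) =
    (\<Sum>k. ennreal (measure \<Lambda> C ^ k / fact k * exp (- measure \<Lambda> C)) * h (of_nat k))"
proof -
  let ?l = "measure \<Lambda> C"
  define A where "A k = {\<omega> \<in> space P. emeasure (\<eta> \<omega>) C = of_nat k}" for k :: nat
  have A [measurable]: "A k \<in> sets P" for k unfolding A_def by measurable
  have disj: "disjoint_family A" by (auto simp: disjoint_family_on_def A_def)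
  have em: "emeasure P (A k) = ennreal (?l ^ k / fact k * exp (- ?l))" for k
    unfolding emeasure_eq_measure A_def poisson_count[OF C fin] ..
  have "(\<lambda>k. ?l ^ k / fact k * exp (- ?l)) sums (exp ?l * exp (- ?l))"
    using exp_converges[of ?l] by (intro sums_mult2) (simp add: field_simps)
  then have sums: "(\<lambda>k. ?l ^ k / fact k * exp (- ?l)) sums 1" by (simp add: exp_minus)
  have "emeasure P (\<Union>k. A k) = (\<Sum>k. emeasure P (A k))"
    using disj by (intro suminf_emeasure[symmetric]) auto
  also have "\<dots> = ennreal 1"
    unfolding em by (rule sums_unique[symmetric]) (subst sums_ennreal, use sums in auto)
  finally have "prob (\<Union>k. A k) = 1" by (simp add: emeasure_eq_measure)
  then have AE: "AE \<omega> in P. \<exists>k. \<omega> \<in> A k" by (auto dest: AE_prob_1)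
  have "(\<integral>\<^sup>+\<omega>. h (emeasure (\<eta> \<omega>) C) \<partial>P) = (\<integral>\<^sup>+\<omega>. (\<Sum>k. h (of_nat k) * indicator (A k) \<omega>) \<partial>P)"
    using AE
  proof (intro nn_integral_cong_AE, elim AE_mp, intro AE_I2 impI)
    fix \<omega> assume "\<exists>k. \<omega> \<in> A k"
    then obtain k where k: "\<omega> \<in> A k" by auto
    then have "(\<Sum>k. h (of_nat k) * indicator (A k) \<omega>) = (\<Sum>i\<in>{k}. h (of_nat i) * indicator (A i) \<omega>)"
      by (intro suminf_finite) (auto simp: A_def)
    with k show "h (emeasure (\<eta> \<omega>) C) = (\<Sum>k. h (of_nat k) * indicator (A k) \<omega>)" by (simp add: A_def)
  qed
  also have "\<dots> = (\<Sum>k. \<integral>\<^sup>+\<omega>. h (of_nat k) * indicator (A k) \<omega> \<partial>P)"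
    by (rule nn_integral_suminf) measurable
  also have "\<dots> = (\<Sum>k. ennreal (?l ^ k / fact k * exp (- ?l)) * h (of_nat k))"
    by (simp add: nn_integral_cmult em mult.commute)
  finally show ?thesis .
qed

text \<open>The Mecke equation for a single count: it is the recursion
  \<open>(k + 1) * p (k + 1) = l * p k\<close> of the Poisson weights \<open>p\<close> with mean
  \<open>l\<close>.\<close>

lemma nn_integral_count_shift:
  fixes g :: "ennreal \<Rightarrow> ennreal"
  assumes C: "C \<in> sets M" and fin: "emeasure \<Lambda> C < \<infinity>"
    and g [measurable]: "g \<in> borel_measurable borel"
  shows "(\<integral>\<^sup>+\<omega>. emeasure (\<eta> \<omega>) C * g (emeasure (\<eta> \<omega>) C) \<partial>P) =
    emeasure \<Lambda> C * (\<integral>\<^sup>+\<omega>. g (emeasure (\<eta> \<omega>) C + 1) \<partial>P)"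
proof -
  let ?l = "measure \<Lambda> C"
  let ?p = "\<lambda>k. ennreal (?l ^ k / fact k * exp (- ?l))"
  have L: "emeasure \<Lambda> C = ennreal ?l" using fin by (simp add: emeasure_eq_ennreal_measure)
  have p: "?p (Suc k) * of_nat (Suc k) = ennreal ?l * ?p k" for k
    by (simp add: ennreal_of_nat_eq_real_of_nat ennreal_mult'[symmetric] field_simps del: of_nat_Suc)
  have "(\<integral>\<^sup>+\<omega>. emeasure (\<eta> \<omega>) C * g (emeasure (\<eta> \<omega>) C) \<partial>P) = (\<Sum>k. ?p k * (of_nat k * g (of_nat k)))"
    using nn_integral_count[OF C fin, of "\<lambda>n. n * g n"] by simp
  \<comment> \<open>The term at \<open>k = 0\<close> vanishes because of the factor
    \<open>k\<close>, so the series may start one index later.\<close>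
  also have "\<dots> = (\<Sum>k. ?p (k + 1) * (of_nat (k + 1) * g (of_nat (k + 1))))"
    by (subst suminf_offset[where i = 1]) auto
  also have "\<dots> = (\<Sum>k. ennreal ?l * (?p k * g (of_nat k + 1)))"
    using p by (simp add: mult.assoc[symmetric] add.commute del: ennreal_suminf_cmult ennreal_suminf_multc)
  also have "\<dots> = emeasure \<Lambda> C * (\<Sum>k. ?p k * g (of_nat k + 1))"
    by (simp only: ennreal_suminf_cmult L)
  also have "(\<Sum>k. ?p k * g (of_nat k + 1)) = (\<integral>\<^sup>+\<omega>. g (emeasure (\<eta> \<omega>) C + 1) \<partial>P)"
    using nn_integral_count[OF C fin, of "\<lambda>n. g (n + 1)"] by simp
  finally show ?thesis .
qed

text \<open>As every \<open>C i\<close> contains or avoids \<open>D\<close>, the cylinder sees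
  \<open>D\<close> only through the number of its points: inserting a point of \<open>D\<close>
  raises that number by one and changes nothing else. With the independent counts of the
  \<open>C i - D\<close> held fixed, the claim is \<open>nn_integral_count_shift\<close>.\<close>

lemma mecke_cylinder_atom:
  assumes D [measurable]: "D \<in> sets M" and fin: "emeasure \<Lambda> D < \<infinity>"
    and C [measurable]: "\<And>i. i < m \<Longrightarrow> C i \<in> sets M"
    and S [measurable]: "\<And>i. i < m \<Longrightarrow> S i \<in> sets borel"
    and atom: "\<And>i. i < m \<Longrightarrow> D \<subseteq> C i \<or> D \<inter> C i = {}"
  shows "(\<integral>\<^sup>+\<omega>. emeasure (\<eta> \<omega>) D * indicator (cylinder m C S) (\<eta> \<omega>) \<partial>P) =
    (\<integral>\<^sup>+x. indicator D x * (\<integral>\<^sup>+\<omega>. indicator (cylinder m C S) (add_point (\<eta> \<omega>) x) \<partial>P) \<partial>\<Lambda>)"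
proof -
  \<comment> \<open>\<open>b i\<close> is 0 or 1 and tells whether points of \<open>D\<close> count
    for \<open>C i\<close>; the count of \<open>C i\<close> is then \<open>b i\<close> times the
    count of \<open>D\<close> plus a remainder independent of the latter.\<close>
  define b :: "nat \<Rightarrow> ennreal" where "b i = of_bool (D \<subseteq> C i)" for i
  define g :: "ennreal \<Rightarrow> (nat \<Rightarrow> ennreal) \<Rightarrow> ennreal"
    where "g n v = (\<Prod>i<m. indicator (S i) (b i * n + v i))" for n v
  let ?V = "\<lambda>\<omega>. \<lambda>j\<in>{..<m}. emeasure (\<eta> \<omega>) (C j - D)"
  let ?B = "\<Pi>\<^sub>M j\<in>{..<m}. borel :: ennreal measure"
  have CD: "j < m \<Longrightarrow> C j - D \<in> sets M" for j by measurable
  have V [measurable]: "?V \<in> measurable P ?B"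
    by (intro measurable_restrict measurable_emeasure_counting CD) auto
  have S': "(\<lambda>(n, v). indicator (S i) (b i * n + v i) :: ennreal) \<in> borel_measurable (borel \<Otimes>\<^sub>M ?B)"
    if i: "i < m" for i
  proof -
    have [measurable]: "(\<lambda>v. v i) \<in> borel_measurable ?B"
      using i by (intro measurable_component_singleton) simp
    show ?thesis using S[OF i] by measurable
  qed
  have g [measurable]: "(\<lambda>(n, v). g n v) \<in> borel_measurable (borel \<Otimes>\<^sub>M ?B)"
    unfolding g_def case_prod_beta
    by (intro borel_measurable_prod_ennreal) (use S' in \<open>auto simp: case_prod_beta\<close>)
  have split: "emeasure (\<eta> \<omega>) (C i) = b i * emeasure (\<eta> \<omega>) D + emeasure (\<eta> \<omega>) (C i - D)"
    if \<omega>: "\<omega> \<in> space P" and i: "i < m" for \<omega> i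
  proof (cases "D \<subseteq> C i")
    case True
    have "emeasure (\<eta> \<omega>) (D \<union> (C i - D)) = emeasure (\<eta> \<omega>) D + emeasure (\<eta> \<omega>) (C i - D)"
      using D CD[OF i] by (intro plus_emeasure[symmetric]) (auto simp: sets_counting[OF eta_counting[OF \<omega>]])
    with True show ?thesis by (simp add: b_def Un_absorb1)
  next
    case False
    with atom[OF i] have "C i - D = C i" by auto
    with False show ?thesis by (simp add: b_def)
  qed
  have ind: "indicator (cylinder m C S) (\<eta> \<omega>) = g (emeasure (\<eta> \<omega>) D) (?V \<omega>)"
    if "\<omega> \<in> space P" for \<omega>
    using that by (auto simp: indicator_cylinder g_def split intro!: prod.cong)
  have ind1: "indicator (cylinder m C S) (add_point (\<eta> \<omega>) x) = g (emeasure (\<eta> \<omega>) D + 1) (?V \<omega>)"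
    if \<omega>: "\<omega> \<in> space P" and x: "x \<in> D" for \<omega> x
  proof -
    have "x \<in> space M" using x sets.sets_into_space[OF D] by auto
    moreover have "indicator (C i) x = b i" if "i < m" for i
      using x atom[OF that] by (auto simp: b_def indicator_def)
    ultimately show ?thesis
      using \<omega> C
      by (auto simp: indicator_cylinder g_def emeasure_add_point split algebra_simps intro!: prod.cong)
  qed
  define Q where "Q = distr P borel (\<lambda>\<omega>. emeasure (\<eta> \<omega>) D)"
  define R where "R = distr P ?B ?V"
  interpret Q: prob_space Q unfolding Q_def by (rule prob_space_distr) simp
  interpret R: prob_space R unfolding R_def by (rule prob_space_distr) simp
  interpret QR: pair_prob_space Q R ..
  have sQ [measurable_cong]: "sets Q = sets borel" by (simp add: Q_def)
  have sR [measurable_cong]: "sets R = sets ?B" by (simp add: R_def)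
  have law: "distr P (borel \<Otimes>\<^sub>M ?B) (\<lambda>\<omega>. (emeasure (\<eta> \<omega>) D, ?V \<omega>)) = Q \<Otimes>\<^sub>M R"
    unfolding Q_def R_def using CD by (intro indep_count_rest) auto
  \<comment> \<open>Fubini for the product law: the counts outside \<open>D\<close> are frozen at
    \<open>v\<close> while the count of \<open>D\<close> is integrated.\<close>
  have transfer: "(\<integral>\<^sup>+\<omega>. f (emeasure (\<eta> \<omega>) D) (?V \<omega>) \<partial>P) = (\<integral>\<^sup>+v. \<integral>\<^sup>+\<omega>. f (emeasure (\<eta> \<omega>) D) v \<partial>P \<partial>R)"
    if f [measurable]: "(\<lambda>(n, v). f n v) \<in> borel_measurable (borel \<Otimes>\<^sub>M ?B)" for f :: "ennreal \<Rightarrow> _ \<Rightarrow> ennreal"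
  proof -
    have "(\<integral>\<^sup>+\<omega>. f (emeasure (\<eta> \<omega>) D) (?V \<omega>) \<partial>P) = (\<integral>\<^sup>+(n, v). f n v \<partial>(Q \<Otimes>\<^sub>M R))"
      unfolding law[symmetric] by (subst nn_integral_distr) auto
    also have "\<dots> = (\<integral>\<^sup>+v. \<integral>\<^sup>+n. f n v \<partial>Q \<partial>R)"
      by (subst QR.nn_integral_snd[symmetric]) auto
    also have "\<dots> = (\<integral>\<^sup>+v. \<integral>\<^sup>+\<omega>. f (emeasure (\<eta> \<omega>) D) v \<partial>P \<partial>R)"
      unfolding Q_def
    proof (intro nn_integral_cong nn_integral_distr)
      fix v assume "v \<in> space R"
      then have "v \<in> space ?B" by (simp add: R_def)
      then show "(\<lambda>n. f n v) \<in> borel_measurable (distr P borel (\<lambda>\<omega>. emeasure (\<eta> \<omega>) D))"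
        by measurable
    qed measurable
    finally show ?thesis .
  qed
  have "(\<integral>\<^sup>+\<omega>. emeasure (\<eta> \<omega>) D * indicator (cylinder m C S) (\<eta> \<omega>) \<partial>P) =
      (\<integral>\<^sup>+\<omega>. emeasure (\<eta> \<omega>) D * g (emeasure (\<eta> \<omega>) D) (?V \<omega>) \<partial>P)"
    by (intro nn_integral_cong) (simp only: ind)
  also have "\<dots> = (\<integral>\<^sup>+v. \<integral>\<^sup>+\<omega>. emeasure (\<eta> \<omega>) D * g (emeasure (\<eta> \<omega>) D) v \<partial>P \<partial>R)"
    by (rule transfer[of "\<lambda>n v. n * g n v"]) measurable
  also have "\<dots> = (\<integral>\<^sup>+v. emeasure \<Lambda> D * \<integral>\<^sup>+\<omega>. g (emeasure (\<eta> \<omega>) D + 1) v \<partial>P \<partial>R)"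
  proof (intro nn_integral_cong nn_integral_count_shift D fin)
    fix v assume "v \<in> space R"
    then have "v \<in> space ?B" by (simp add: R_def)
    then show "(\<lambda>n. g n v) \<in> borel_measurable borel" by measurable
  qed
  also have "\<dots> = emeasure \<Lambda> D * (\<integral>\<^sup>+v. \<integral>\<^sup>+\<omega>. g (emeasure (\<eta> \<omega>) D + 1) v \<partial>P \<partial>R)"
    by (rule nn_integral_cmult) measurable
  also have "(\<integral>\<^sup>+v. \<integral>\<^sup>+\<omega>. g (emeasure (\<eta> \<omega>) D + 1) v \<partial>P \<partial>R) = (\<integral>\<^sup>+\<omega>. g (emeasure (\<eta> \<omega>) D + 1) (?V \<omega>) \<partial>P)"
    by (rule transfer[of "\<lambda>n v. g (n + 1) v", symmetric]) measurable
  \<comment> \<open>The inner integral is the same for all points of \<open>D\<close>, so the factor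
    \<open>emeasure \<Lambda> D\<close> can be written as an integral over \<open>D\<close>.\<close>
  also have "emeasure \<Lambda> D * \<dots> = (\<integral>\<^sup>+x. indicator D x * (\<integral>\<^sup>+\<omega>. g (emeasure (\<eta> \<omega>) D + 1) (?V \<omega>) \<partial>P) \<partial>\<Lambda>)"
    by (simp add: nn_integral_multc)
  also have "\<dots> = (\<integral>\<^sup>+x. indicator D x * (\<integral>\<^sup>+\<omega>. indicator (cylinder m C S) (add_point (\<eta> \<omega>) x) \<partial>P) \<partial>\<Lambda>)"
    by (auto intro!: nn_integral_cong simp: indicator_def[of D] ind1)
  finally show ?thesis .
qed

text \<open>Cutting \<open>B\<close> along the \<open>C i\<close> one after the other reduces the claim to pieces each of which
  is contained in or disjoint from every \<open>C i\<close>.\<close>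

lemma mecke_cylinder:
  assumes B [measurable]: "B \<in> sets M" and fin: "emeasure \<Lambda> B < \<infinity>"
    and C [measurable]: "\<And>i. i < m \<Longrightarrow> C i \<in> sets M"
    and S [measurable]: "\<And>i. i < m \<Longrightarrow> S i \<in> sets borel"
  shows "(\<integral>\<^sup>+\<omega>. emeasure (\<eta> \<omega>) B * indicator (cylinder m C S) (\<eta> \<omega>) \<partial>P) =
    (\<integral>\<^sup>+x. indicator B x * (\<integral>\<^sup>+\<omega>. indicator (cylinder m C S) (add_point (\<eta> \<omega>) x) \<partial>P) \<partial>\<Lambda>)"
proof -
  have cyl [measurable]: "cylinder m C S \<in> sets \<N>" using C S by (rule cylinder_sets)
  \<comment> \<open>\<open>k\<close> bounds the indices of the sets that may still cut through
    \<open>B\<close>: none at \<open>k = 0\<close>, where the atomic case applies, and no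
    restriction at all at \<open>k = m\<close>. The step from \<open>k\<close> to
    \<open>Suc k\<close> cuts \<open>B\<close> along \<open>C k\<close>.\<close>
  have "\<lbrakk>B \<in> sets M; emeasure \<Lambda> B < \<infinity>; \<And>i. k \<le> i \<Longrightarrow> i < m \<Longrightarrow> B \<subseteq> C i \<or> B \<inter> C i = {}\<rbrakk> \<Longrightarrow>
    (\<integral>\<^sup>+\<omega>. emeasure (\<eta> \<omega>) B * indicator (cylinder m C S) (\<eta> \<omega>) \<partial>P) =
    (\<integral>\<^sup>+x. indicator B x * (\<integral>\<^sup>+\<omega>. indicator (cylinder m C S) (add_point (\<eta> \<omega>) x) \<partial>P) \<partial>\<Lambda>)" for k
  proof (induction k arbitrary: B)
    case 0
    then show ?case using C S by (intro mecke_cylinder_atom) auto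
  next
    case (Suc k)
    show ?case
    proof (cases "k < m")
      case False
      then show ?thesis using Suc by auto
    next
      case True
      let ?F = "\<lambda>x. \<integral>\<^sup>+\<omega>. indicator (cylinder m C S) (add_point (\<eta> \<omega>) x) \<partial>P"
      note [measurable] = Suc.prems(1) C[OF True]
      have F [measurable]: "?F \<in> borel_measurable \<Lambda>" by measurable
      have IH: "(\<integral>\<^sup>+\<omega>. emeasure (\<eta> \<omega>) A * indicator (cylinder m C S) (\<eta> \<omega>) \<partial>P) =
          (\<integral>\<^sup>+x. indicator A x * ?F x \<partial>\<Lambda>)" if A: "A = B \<inter> C k \<or> A = B - C k" for A
      proof (rule Suc.IH)
        show "A \<in> sets M" using A by auto
        have "A \<subseteq> B" using A by auto
        then show "emeasure \<Lambda> A < \<infinity>"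
          using Suc.prems(1,2) emeasure_mono[of A B \<Lambda>] by auto
        fix i assume "k \<le> i" "i < m"
        with A Suc.prems(3)[of i] show "A \<subseteq> C i \<or> A \<inter> C i = {}" by (cases "i = k") auto
      qed
      have "(\<integral>\<^sup>+\<omega>. emeasure (\<eta> \<omega>) B * indicator (cylinder m C S) (\<eta> \<omega>) \<partial>P) =
          (\<integral>\<^sup>+\<omega>. emeasure (\<eta> \<omega>) (B \<inter> C k) * indicator (cylinder m C S) (\<eta> \<omega>)
            + emeasure (\<eta> \<omega>) (B - C k) * indicator (cylinder m C S) (\<eta> \<omega>) \<partial>P)"
      proof (intro nn_integral_cong)
        fix \<omega> assume "\<omega> \<in> space P"
        then have "emeasure (\<eta> \<omega>) ((B \<inter> C k) \<union> (B - C k)) = emeasure (\<eta> \<omega>) (B \<inter> C k) + emeasure (\<eta> \<omega>) (B - C k)"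
          by (intro plus_emeasure[symmetric]) (auto simp: sets_counting)
        moreover have "(B \<inter> C k) \<union> (B - C k) = B" by auto
        ultimately show "emeasure (\<eta> \<omega>) B * indicator (cylinder m C S) (\<eta> \<omega>) =
            emeasure (\<eta> \<omega>) (B \<inter> C k) * indicator (cylinder m C S) (\<eta> \<omega>)
            + emeasure (\<eta> \<omega>) (B - C k) * indicator (cylinder m C S) (\<eta> \<omega>)"
          by (simp add: distrib_right)
      qed
      also have "\<dots> = (\<integral>\<^sup>+x. indicator (B \<inter> C k) x * ?F x \<partial>\<Lambda>) + (\<integral>\<^sup>+x. indicator (B - C k) x * ?F x \<partial>\<Lambda>)"
        by (subst nn_integral_add) (auto simp: IH)
      also have "\<dots> = (\<integral>\<^sup>+x. indicator (B \<inter> C k) x * ?F x + indicator (B - C k) x * ?F x \<partial>\<Lambda>)"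
        by (rule nn_integral_add[symmetric]) measurable
      also have "\<dots> = (\<integral>\<^sup>+x. indicator B x * ?F x \<partial>\<Lambda>)"
        by (intro nn_integral_cong) (auto split: split_indicator)
      finally show ?thesis .
    qed
  qed
  from this[of m] B fin show ?thesis by auto
qed

section \<open>The Mecke equation for general events and integrands\<close>

sublocale \<Lambda>P: pair_sigma_finite \<Lambda> P ..

text \<open>Both sides are finite measures in \<open>A\<close>: the image under
  \<open>\<eta>\<close> of \<open>P\<close> weighted by the count of \<open>B\<close>, and the image
  under insertion of the product of \<open>\<Lambda>\<close> on \<open>B\<close> with
  \<open>P\<close>. They agree on the cylinders, an intersection-stable generator.\<close>

lemma mecke_event:
  assumes B [measurable]: "B \<in> sets M" and fin: "emeasure \<Lambda> B < \<infinity>" and A: "A \<in> sets \<N>"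
  shows "(\<integral>\<^sup>+\<omega>. emeasure (\<eta> \<omega>) B * indicator A (\<eta> \<omega>) \<partial>P) =
    (\<integral>\<^sup>+x. indicator B x * (\<integral>\<^sup>+\<omega>. indicator A (add_point (\<eta> \<omega>) x) \<partial>P) \<partial>\<Lambda>)"
proof -
  let ?L = "distr (density P (\<lambda>\<omega>. emeasure (\<eta> \<omega>) B)) \<N> \<eta>"
  let ?R = "distr (density (\<Lambda> \<Otimes>\<^sub>M P) (\<lambda>(x, \<omega>). indicator B x)) \<N> (\<lambda>(x, \<omega>). add_point (\<eta> \<omega>) x)"
  have L: "emeasure ?L A = (\<integral>\<^sup>+\<omega>. emeasure (\<eta> \<omega>) B * indicator A (\<eta> \<omega>) \<partial>P)"
    if [measurable]: "A \<in> sets \<N>" for A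
    by (subst emeasure_distr) (auto simp: emeasure_density intro!: nn_integral_cong split: split_indicator)
  have R: "emeasure ?R A = (\<integral>\<^sup>+x. indicator B x * (\<integral>\<^sup>+\<omega>. indicator A (add_point (\<eta> \<omega>) x) \<partial>P) \<partial>\<Lambda>)"
    if [measurable]: "A \<in> sets \<N>" for A
  proof -
    have "emeasure ?R A = (\<integral>\<^sup>+z. indicator B (fst z) * indicator A (add_point (\<eta> (snd z)) (fst z)) \<partial>(\<Lambda> \<Otimes>\<^sub>M P))"
    proof -
      have "emeasure ?R A = (\<integral>\<^sup>+\<mu>. indicator A \<mu> \<partial>?R)" by simp
      also have "\<dots> = (\<integral>\<^sup>+z. indicator A (add_point (\<eta> (snd z)) (fst z))
          \<partial>density (\<Lambda> \<Otimes>\<^sub>M P) (\<lambda>(x, \<omega>). indicator B x))"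
        by (subst nn_integral_distr) (auto simp: case_prod_beta)
      finally show ?thesis by (simp add: nn_integral_density case_prod_beta)
    qed
    also have "\<dots> = (\<integral>\<^sup>+x. \<integral>\<^sup>+\<omega>. indicator B x * indicator A (add_point (\<eta> \<omega>) x) \<partial>P \<partial>\<Lambda>)"
      by (subst nn_integral_fst[symmetric]) auto
    also have "\<dots> = (\<integral>\<^sup>+x. indicator B x * (\<integral>\<^sup>+\<omega>. indicator A (add_point (\<eta> \<omega>) x) \<partial>P) \<partial>\<Lambda>)"
      by (intro nn_integral_cong nn_integral_cmult) auto
    finally show ?thesis .
  qed
  have cyl: "emeasure ?L A = emeasure ?R A" if "A \<in> cylinders" for A
  proof -
    obtain m C S where "A = cylinder m C S" "\<And>i. i < m \<Longrightarrow> C i \<in> sets M" "\<And>i. i < m \<Longrightarrow> S i \<in> sets borel"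
      using \<open>A \<in> cylinders\<close> unfolding cylinders_def by blast
    then show ?thesis
      using mecke_cylinder[OF B fin] by (simp add: L R cylinder_sets)
  qed
  have "?L = ?R"
  proof (rule measure_eqI_generator_eq[OF Int_stable_cylinders, where A = "\<lambda>_. space \<N>" and \<Omega> = "space \<N>"])
    show "cylinders \<subseteq> Pow (space \<N>)" by (auto simp: cylinders_def cylinder_def)
    have "emeasure ?R (space \<N>) = (\<integral>\<^sup>+x. indicator B x \<partial>\<Lambda>)"
      by (auto simp: R emeasure_space_1 intro!: nn_integral_cong split: split_indicator
        cong: nn_integral_cong_simp)
    \<comment> \<open>The whole space is itself a cylinder, so the two total masses agree; the right
      one is \<open>emeasure \<Lambda> B\<close>.\<close>
    then show "emeasure ?L (space \<N>) \<noteq> \<infinity>"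
      using fin cyl[OF space_in_cylinders] by simp
  qed (auto simp: cyl sets_counting_algebra_cylinders space_in_cylinders)
  then show ?thesis using L[OF A] R[OF A] by simp
qed

text \<open>Passage to events of point and configuration jointly, starting from rectangles, for
  which it is \<open>mecke_event\<close>. Within \<open>Bs n\<close> both total masses equal the
  finite number \<open>emeasure \<Lambda> (Bs n)\<close>, so complements can be handled by
  cancellation.\<close>

lemma mecke_bounded:
  assumes W: "W \<in> sets (M \<Otimes>\<^sub>M \<N>)"
  shows "(\<integral>\<^sup>+\<omega>. emeasure (\<eta> \<omega>) ({x \<in> space M. (x, \<eta> \<omega>) \<in> W} \<inter> Bs n) \<partial>P) =
    (\<integral>\<^sup>+x. indicator (Bs n) x * (\<integral>\<^sup>+\<omega>. indicator W (x, add_point (\<eta> \<omega>) x) \<partial>P) \<partial>\<Lambda>)"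
proof -
  let ?L = "\<lambda>W. \<integral>\<^sup>+\<omega>. emeasure (\<eta> \<omega>) ({x \<in> space M. (x, \<eta> \<omega>) \<in> W} \<inter> Bs n) \<partial>P"
  let ?R = "\<lambda>W. \<integral>\<^sup>+x. indicator (Bs n) x * (\<integral>\<^sup>+\<omega>. indicator W (x, add_point (\<eta> \<omega>) x) \<partial>P) \<partial>\<Lambda>"
  have cut [measurable]: "{x \<in> space M. (x, \<mu>) \<in> W} \<in> sets M" if [measurable]: "W \<in> sets (M \<Otimes>\<^sub>M \<N>)" and "\<mu> \<in> space \<N>" for W \<mu>
    using that(2) by measurable
  have meas [measurable]: "(\<lambda>\<omega>. emeasure (\<eta> \<omega>) ({x \<in> space M. (x, \<eta> \<omega>) \<in> W} \<inter> Bs n)) \<in> borel_measurable P"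
    if W: "W \<in> sets (M \<Otimes>\<^sub>M \<N>)" for W
  proof -
    have "W \<inter> Bs n \<times> space \<N> \<in> sets (M \<Otimes>\<^sub>M \<N>)" using W by measurable
    from measurable_kernel_emeasure[OF measurable_ident this]
    have "(\<lambda>\<mu>. emeasure \<mu> {y \<in> space M. (y, \<mu>) \<in> W \<inter> Bs n \<times> space \<N>}) \<in> borel_measurable \<N>" by simp
    from measurable_compose[OF eta_measurable this] show ?thesis
      by (rule measurable_cong[THEN iffD1, rotated])
         (auto intro!: arg_cong2[where f = emeasure] simp: eta_counting)
  qed
  have full: "?L (space M \<times> space \<N>) = emeasure \<Lambda> (Bs n)" "?R (space M \<times> space \<N>) = emeasure \<Lambda> (Bs n)"
  proof -
    have "?R (space M \<times> space \<N>) = (\<integral>\<^sup>+x. indicator (Bs n) x \<partial>\<Lambda>)"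
      using sets.sets_into_space[OF sets_Bs[of n]]
      by (auto simp: emeasure_space_1 indicator_def[of "_ \<times> _"] intro!: nn_integral_cong split: split_indicator
        cong: nn_integral_cong_simp)
    then show R: "?R (space M \<times> space \<N>) = emeasure \<Lambda> (Bs n)" by simp
    have "?L (space M \<times> space \<N>) = (\<integral>\<^sup>+\<omega>. emeasure (\<eta> \<omega>) (Bs n) * indicator (space \<N>) (\<eta> \<omega>) \<partial>P)"
      using sets.sets_into_space[OF sets_Bs[of n]]
      by (intro nn_integral_cong) (auto intro!: arg_cong2[where f = emeasure])
    also have "\<dots> = (\<integral>\<^sup>+x. indicator (Bs n) x * (\<integral>\<^sup>+\<omega>. indicator (space \<N>) (add_point (\<eta> \<omega>) x) \<partial>P) \<partial>\<Lambda>)"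
      by (intro mecke_event Lambda_bounded[of _ n]) auto
    also have "\<dots> = ?R (space M \<times> space \<N>)"
      using sets.sets_into_space[OF sets_Bs[of n]]
      by (intro nn_integral_cong) (auto intro!: nn_integral_cong split: split_indicator)
    finally show "?L (space M \<times> space \<N>) = emeasure \<Lambda> (Bs n)" using R by simp
  qed
  show "?L W = ?R W"
    using Int_stable_pair_measure_generator pair_measure_closed W
    unfolding sets_pair_measure
  proof (induct rule: sigma_sets_induct_disjoint)
    case (basic V)
    then obtain C A where V: "V = C \<times> A" and [measurable]: "C \<in> sets M" "A \<in> sets \<N>" by auto
    have "?L V = (\<integral>\<^sup>+\<omega>. emeasure (\<eta> \<omega>) (C \<inter> Bs n) * indicator A (\<eta> \<omega>) \<partial>P)"
      using sets.sets_into_space[OF \<open>C \<in> sets M\<close>]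
      by (intro nn_integral_cong) (auto simp: V split: split_indicator intro!: arg_cong2[where f = emeasure])
    also have "\<dots> = (\<integral>\<^sup>+x. indicator (C \<inter> Bs n) x * (\<integral>\<^sup>+\<omega>. indicator A (add_point (\<eta> \<omega>) x) \<partial>P) \<partial>\<Lambda>)"
      by (intro mecke_event Lambda_bounded[of _ n]) auto
    also have "\<dots> = ?R V"
      by (intro nn_integral_cong) (auto simp: V split: split_indicator intro!: nn_integral_cong)
    finally show ?case .
  next
    case (compl V)
    then have [measurable]: "V \<in> sets (M \<Otimes>\<^sub>M \<N>)" by (simp add: sets_pair_measure)
    let ?V' = "space M \<times> space \<N> - V"
    have [measurable]: "?V' \<in> sets (M \<Otimes>\<^sub>M \<N>)"
      using sets.compl_sets[OF \<open>V \<in> sets (M \<Otimes>\<^sub>M \<N>)\<close>] by (simp add: space_pair_measure)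
    have "?L V + ?L ?V' = (\<integral>\<^sup>+\<omega>. emeasure (\<eta> \<omega>) ({x \<in> space M. (x, \<eta> \<omega>) \<in> V} \<inter> Bs n)
        + emeasure (\<eta> \<omega>) ({x \<in> space M. (x, \<eta> \<omega>) \<in> ?V'} \<inter> Bs n) \<partial>P)"
      by (intro nn_integral_add[symmetric] meas) auto
    also have "\<dots> = ?L (space M \<times> space \<N>)"
    proof (intro nn_integral_cong)
      fix \<omega> assume \<omega>: "\<omega> \<in> space P"
      have "emeasure (\<eta> \<omega>) ({x \<in> space M. (x, \<eta> \<omega>) \<in> V} \<inter> Bs n)
          + emeasure (\<eta> \<omega>) ({x \<in> space M. (x, \<eta> \<omega>) \<in> ?V'} \<inter> Bs n) =
        emeasure (\<eta> \<omega>) (({x \<in> space M. (x, \<eta> \<omega>) \<in> V} \<inter> Bs n) \<union> ({x \<in> space M. (x, \<eta> \<omega>) \<in> ?V'} \<inter> Bs n))"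
        using \<omega> by (intro plus_emeasure) (auto simp: sets_counting cut)
      also have "({x \<in> space M. (x, \<eta> \<omega>) \<in> V} \<inter> Bs n) \<union> ({x \<in> space M. (x, \<eta> \<omega>) \<in> ?V'} \<inter> Bs n)
          = {x \<in> space M. (x, \<eta> \<omega>) \<in> space M \<times> space \<N>} \<inter> Bs n"
        using \<omega> sets.sets_into_space[OF sets_Bs[of n]] by auto
      finally show "emeasure (\<eta> \<omega>) ({x \<in> space M. (x, \<eta> \<omega>) \<in> V} \<inter> Bs n)
          + emeasure (\<eta> \<omega>) ({x \<in> space M. (x, \<eta> \<omega>) \<in> ?V'} \<inter> Bs n) =
        emeasure (\<eta> \<omega>) ({x \<in> space M. (x, \<eta> \<omega>) \<in> space M \<times> space \<N>} \<inter> Bs n)" .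
    qed
    finally have L: "?L V + ?L ?V' = ?L (space M \<times> space \<N>)" .
    have "?R V + ?R ?V' = (\<integral>\<^sup>+x. indicator (Bs n) x * (\<integral>\<^sup>+\<omega>. indicator V (x, add_point (\<eta> \<omega>) x) \<partial>P)
        + indicator (Bs n) x * (\<integral>\<^sup>+\<omega>. indicator ?V' (x, add_point (\<eta> \<omega>) x) \<partial>P) \<partial>\<Lambda>)"
      by (rule nn_integral_add[symmetric]) measurable
    also have "\<dots> = ?R (space M \<times> space \<N>)"
    proof (intro nn_integral_cong)
      fix x assume "x \<in> space \<Lambda>"
      then have x [measurable]: "x \<in> space M" by simp
      have "(\<integral>\<^sup>+\<omega>. indicator V (x, add_point (\<eta> \<omega>) x) \<partial>P) + (\<integral>\<^sup>+\<omega>. indicator ?V' (x, add_point (\<eta> \<omega>) x) \<partial>P)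
        = (\<integral>\<^sup>+\<omega>. indicator V (x, add_point (\<eta> \<omega>) x) + indicator ?V' (x, add_point (\<eta> \<omega>) x) \<partial>P)"
        by (rule nn_integral_add[symmetric]) measurable
      also have "\<dots> = (\<integral>\<^sup>+\<omega>. indicator (space M \<times> space \<N>) (x, add_point (\<eta> \<omega>) x) \<partial>P)"
        using x by (intro nn_integral_cong) (auto split: split_indicator)
      finally show "indicator (Bs n) x * (\<integral>\<^sup>+\<omega>. indicator V (x, add_point (\<eta> \<omega>) x) \<partial>P)
          + indicator (Bs n) x * (\<integral>\<^sup>+\<omega>. indicator ?V' (x, add_point (\<eta> \<omega>) x) \<partial>P) =
        indicator (Bs n) x * (\<integral>\<^sup>+\<omega>. indicator (space M \<times> space \<N>) (x, add_point (\<eta> \<omega>) x) \<partial>P)"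
        by (simp add: distrib_left[symmetric])
    qed
    finally have R: "?R V + ?R ?V' = ?R (space M \<times> space \<N>)" .
    \<comment> \<open>Finiteness of the common summand is what permits its cancellation in
      \<open>ennreal\<close>.\<close>
    have "?R V \<le> ?R V + ?R ?V'" by simp
    also have "\<dots> < \<infinity>" unfolding R full using Lambda_bounded[of "Bs n" n] by simp
    finally have "?R V \<noteq> \<infinity>" by simp
    moreover have "?R V + ?L ?V' = ?R V + ?R ?V'"
      using L R full compl(2) by simp
    ultimately show ?case by (simp add: ennreal_add_left_cancel)
  next
    case (union F)
    then have [measurable]: "F i \<in> sets (M \<Otimes>\<^sub>M \<N>)" for i by (auto simp: sets_pair_measure)
    have "?L (\<Union> (range F)) = (\<integral>\<^sup>+\<omega>. (\<Sum>i. emeasure (\<eta> \<omega>) ({x \<in> space M. (x, \<eta> \<omega>) \<in> F i} \<inter> Bs n)) \<partial>P)"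
    proof (intro nn_integral_cong)
      fix \<omega> assume \<omega>: "\<omega> \<in> space P"
      have "{x \<in> space M. (x, \<eta> \<omega>) \<in> \<Union> (range F)} \<inter> Bs n = (\<Union>i. {x \<in> space M. (x, \<eta> \<omega>) \<in> F i} \<inter> Bs n)"
        by auto
      also have "emeasure (\<eta> \<omega>) \<dots> = (\<Sum>i. emeasure (\<eta> \<omega>) ({x \<in> space M. (x, \<eta> \<omega>) \<in> F i} \<inter> Bs n))"
        using \<omega> union(1)
        by (intro suminf_emeasure[symmetric]) (auto simp: sets_counting cut disjoint_family_on_def)
      finally show "emeasure (\<eta> \<omega>) ({x \<in> space M. (x, \<eta> \<omega>) \<in> \<Union> (range F)} \<inter> Bs n)
        = (\<Sum>i. emeasure (\<eta> \<omega>) ({x \<in> space M. (x, \<eta> \<omega>) \<in> F i} \<inter> Bs n))" .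
    qed
    also have "\<dots> = (\<Sum>i. ?L (F i))" by (intro nn_integral_suminf meas) auto
    also have "\<dots> = (\<Sum>i. ?R (F i))" using union by simp
    also have "\<dots> = (\<integral>\<^sup>+x. (\<Sum>i. indicator (Bs n) x * (\<integral>\<^sup>+\<omega>. indicator (F i) (x, add_point (\<eta> \<omega>) x) \<partial>P)) \<partial>\<Lambda>)"
      by (rule nn_integral_suminf[symmetric]) measurable
    also have "\<dots> = ?R (\<Union> (range F))"
    proof (intro nn_integral_cong)
      fix x assume "x \<in> space \<Lambda>"
      then have x [measurable]: "x \<in> space M" by simp
      have "(\<Sum>i. \<integral>\<^sup>+\<omega>. indicator (F i) (x, add_point (\<eta> \<omega>) x) \<partial>P)
          = (\<integral>\<^sup>+\<omega>. (\<Sum>i. indicator (F i) (x, add_point (\<eta> \<omega>) x)) \<partial>P)"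
        by (rule nn_integral_suminf[symmetric]) measurable
      also have "\<dots> = (\<integral>\<^sup>+\<omega>. indicator (\<Union> (range F)) (x, add_point (\<eta> \<omega>) x) \<partial>P)"
        using union(1) by (simp add: suminf_indicator)
      finally show "(\<Sum>i. indicator (Bs n) x * (\<integral>\<^sup>+\<omega>. indicator (F i) (x, add_point (\<eta> \<omega>) x) \<partial>P))
        = indicator (Bs n) x * (\<integral>\<^sup>+\<omega>. indicator (\<Union> (range F)) (x, add_point (\<eta> \<omega>) x) \<partial>P)" by simp
    qed
    finally show ?case .
  qed simp
qed

text \<open>Standard extension from indicators to nonnegative integrands; in the indicator case the
  restriction to \<open>Bs n\<close> is lifted by monotone convergence on both sides.\<close>

lemma mecke:
  fixes h :: "'a \<times> 'a measure \<Rightarrow> ennreal"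
  assumes h: "h \<in> borel_measurable (M \<Otimes>\<^sub>M \<N>)"
  shows "(\<integral>\<^sup>+\<omega>. \<integral>\<^sup>+x. h (x, \<eta> \<omega>) \<partial>\<eta> \<omega> \<partial>P) = (\<integral>\<^sup>+x. \<integral>\<^sup>+\<omega>. h (x, add_point (\<eta> \<omega>) x) \<partial>P \<partial>\<Lambda>)"
proof -
  have m: "(\<lambda>x. g (x, \<eta> \<omega>)) \<in> borel_measurable (\<eta> \<omega>)"
    if "g \<in> borel_measurable (M \<Otimes>\<^sub>M \<N>)" "\<omega> \<in> space P" for g :: "'a \<times> 'a measure \<Rightarrow> ennreal" and \<omega>
    using that by (simp add: measurable_cong_sets[OF sets_counting[OF eta_counting] refl])
  have k: "(\<lambda>\<omega>. \<integral>\<^sup>+x. g (x, \<eta> \<omega>) \<partial>\<eta> \<omega>) \<in> borel_measurable P"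
    if "g \<in> borel_measurable (M \<Otimes>\<^sub>M \<N>)" for g :: "'a \<times> 'a measure \<Rightarrow> ennreal"
    using measurable_kernel_nn_integral[OF measurable_ident, of g] that
    by (intro measurable_compose[OF eta_measurable]) simp
  show ?thesis
    using h
  proof (induct rule: borel_measurable_induct)
    case (cong f g)
    have "(\<integral>\<^sup>+\<omega>. \<integral>\<^sup>+x. f (x, \<eta> \<omega>) \<partial>\<eta> \<omega> \<partial>P) = (\<integral>\<^sup>+\<omega>. \<integral>\<^sup>+x. g (x, \<eta> \<omega>) \<partial>\<eta> \<omega> \<partial>P)"
      by (intro nn_integral_cong cong(3)) (auto simp: space_counting space_pair_measure)
    moreover have "(\<integral>\<^sup>+x. \<integral>\<^sup>+\<omega>. f (x, add_point (\<eta> \<omega>) x) \<partial>P \<partial>\<Lambda>) = (\<integral>\<^sup>+x. \<integral>\<^sup>+\<omega>. g (x, add_point (\<eta> \<omega>) x) \<partial>P \<partial>\<Lambda>)"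
      by (intro nn_integral_cong cong(3)) (auto simp: space_pair_measure)
    ultimately show ?case using cong(4) by simp
  next
    case (set W)
    note [measurable] = set
    have cut: "{x \<in> space M. (x, \<eta> \<omega>) \<in> W} \<in> sets M" if "\<omega> \<in> space P" for \<omega>
      using measurable_space[OF eta_measurable that] by measurable
    have meas: "(\<lambda>\<omega>. emeasure (\<eta> \<omega>) ({x \<in> space M. (x, \<eta> \<omega>) \<in> W} \<inter> Bs n)) \<in> borel_measurable P" for n
    proof -
      have "W \<inter> Bs n \<times> space \<N> \<in> sets (M \<Otimes>\<^sub>M \<N>)" by measurable
      from measurable_kernel_emeasure[OF measurable_ident this]
      have "(\<lambda>\<mu>. emeasure \<mu> {y \<in> space M. (y, \<mu>) \<in> W \<inter> Bs n \<times> space \<N>}) \<in> borel_measurable \<N>" by simp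
      from measurable_compose[OF eta_measurable this] show ?thesis
        by (rule measurable_cong[THEN iffD1, rotated])
           (auto intro!: arg_cong2[where f = emeasure] simp: eta_counting)
    qed
    have "(\<integral>\<^sup>+\<omega>. \<integral>\<^sup>+x. indicator W (x, \<eta> \<omega>) \<partial>\<eta> \<omega> \<partial>P) =
        (\<integral>\<^sup>+\<omega>. (SUP n. emeasure (\<eta> \<omega>) ({x \<in> space M. (x, \<eta> \<omega>) \<in> W} \<inter> Bs n)) \<partial>P)"
    proof (intro nn_integral_cong)
      fix \<omega> assume \<omega>: "\<omega> \<in> space P"
      have "(\<integral>\<^sup>+x. indicator W (x, \<eta> \<omega>) \<partial>\<eta> \<omega>) = (\<integral>\<^sup>+x. indicator {x \<in> space M. (x, \<eta> \<omega>) \<in> W} x \<partial>\<eta> \<omega>)"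
        using \<omega> by (intro nn_integral_cong) (auto simp: space_counting split: split_indicator)
      also have "\<dots> = emeasure (\<eta> \<omega>) {x \<in> space M. (x, \<eta> \<omega>) \<in> W}"
        using cut[OF \<omega>] \<omega> by (intro nn_integral_indicator) (simp add: sets_counting)
      also have "\<dots> = (SUP n. emeasure (\<eta> \<omega>) ({x \<in> space M. (x, \<eta> \<omega>) \<in> W} \<inter> Bs n))"
        using \<omega> cut by (intro SUP_emeasure_Bs[symmetric]) (auto simp: sets_counting)
      finally show "(\<integral>\<^sup>+x. indicator W (x, \<eta> \<omega>) \<partial>\<eta> \<omega>)
        = (SUP n. emeasure (\<eta> \<omega>) ({x \<in> space M. (x, \<eta> \<omega>) \<in> W} \<inter> Bs n))" .
    qed
    also have "\<dots> = (SUP n. \<integral>\<^sup>+\<omega>. emeasure (\<eta> \<omega>) ({x \<in> space M. (x, \<eta> \<omega>) \<in> W} \<inter> Bs n) \<partial>P)"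
    proof (intro nn_integral_monotone_convergence_SUP_AE meas AE_I2)
      fix n \<omega> assume "\<omega> \<in> space P"
      then show "emeasure (\<eta> \<omega>) ({x \<in> space M. (x, \<eta> \<omega>) \<in> W} \<inter> Bs n)
          \<le> emeasure (\<eta> \<omega>) ({x \<in> space M. (x, \<eta> \<omega>) \<in> W} \<inter> Bs (Suc n))"
        using incseq_SucD[OF incseq_Bs, of n] cut by (intro emeasure_mono) (auto simp: sets_counting)
    qed
    also have "\<dots> = (SUP n. \<integral>\<^sup>+x. indicator (Bs n) x * (\<integral>\<^sup>+\<omega>. indicator W (x, add_point (\<eta> \<omega>) x) \<partial>P) \<partial>\<Lambda>)"
      by (simp only: mecke_bounded[OF set])
    also have "\<dots> = (\<integral>\<^sup>+x. (SUP n. indicator (Bs n) x * (\<integral>\<^sup>+\<omega>. indicator W (x, add_point (\<eta> \<omega>) x) \<partial>P)) \<partial>\<Lambda>)"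
    proof (intro nn_integral_monotone_convergence_SUP[symmetric] incseq_SucI le_funI mult_right_mono)
      fix n x show "indicator (Bs n) x \<le> (indicator (Bs (Suc n)) x :: ennreal)"
        using incseq_SucD[OF incseq_Bs, of n] by (auto split: split_indicator)
    qed auto
    also have "\<dots> = (\<integral>\<^sup>+x. \<integral>\<^sup>+\<omega>. indicator W (x, add_point (\<eta> \<omega>) x) \<partial>P \<partial>\<Lambda>)"
    proof (intro nn_integral_cong antisym SUP_least)
      fix x assume "x \<in> space \<Lambda>"
      then obtain n where "x \<in> Bs n" using UN_Bs by auto
      then show "(\<integral>\<^sup>+\<omega>. indicator W (x, add_point (\<eta> \<omega>) x) \<partial>P)
        \<le> (SUP n. indicator (Bs n) x * (\<integral>\<^sup>+\<omega>. indicator W (x, add_point (\<eta> \<omega>) x) \<partial>P))"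
        by (intro SUP_upper2[of n]) auto
    qed (auto split: split_indicator)
    finally show ?case .
  next
    case (mult u c)
    note [measurable] = mult(2)
    have "(\<integral>\<^sup>+\<omega>. \<integral>\<^sup>+x. c * u (x, \<eta> \<omega>) \<partial>\<eta> \<omega> \<partial>P) = (\<integral>\<^sup>+\<omega>. c * (\<integral>\<^sup>+x. u (x, \<eta> \<omega>) \<partial>\<eta> \<omega>) \<partial>P)"
      using m mult by (intro nn_integral_cong nn_integral_cmult) auto
    also have "\<dots> = c * (\<integral>\<^sup>+x. \<integral>\<^sup>+\<omega>. u (x, add_point (\<eta> \<omega>) x) \<partial>P \<partial>\<Lambda>)"
      using mult k by (simp add: nn_integral_cmult)
    also have "\<dots> = (\<integral>\<^sup>+x. c * (\<integral>\<^sup>+\<omega>. u (x, add_point (\<eta> \<omega>) x) \<partial>P) \<partial>\<Lambda>)"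
      by (rule nn_integral_cmult[symmetric]) measurable
    also have "\<dots> = (\<integral>\<^sup>+x. \<integral>\<^sup>+\<omega>. c * u (x, add_point (\<eta> \<omega>) x) \<partial>P \<partial>\<Lambda>)"
      by (intro nn_integral_cong nn_integral_cmult[symmetric]) auto
    finally show ?case .
  next
    case (add u v)
    note [measurable] = add(1,4)
    have "(\<integral>\<^sup>+\<omega>. \<integral>\<^sup>+x. u (x, \<eta> \<omega>) + v (x, \<eta> \<omega>) \<partial>\<eta> \<omega> \<partial>P)
        = (\<integral>\<^sup>+\<omega>. (\<integral>\<^sup>+x. u (x, \<eta> \<omega>) \<partial>\<eta> \<omega>) + (\<integral>\<^sup>+x. v (x, \<eta> \<omega>) \<partial>\<eta> \<omega>) \<partial>P)"
      using m add by (intro nn_integral_cong nn_integral_add) auto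
    also have "\<dots> = (\<integral>\<^sup>+x. \<integral>\<^sup>+\<omega>. u (x, add_point (\<eta> \<omega>) x) \<partial>P \<partial>\<Lambda>) + (\<integral>\<^sup>+x. \<integral>\<^sup>+\<omega>. v (x, add_point (\<eta> \<omega>) x) \<partial>P \<partial>\<Lambda>)"
      using add k by (simp add: nn_integral_add)
    also have "\<dots> = (\<integral>\<^sup>+x. (\<integral>\<^sup>+\<omega>. u (x, add_point (\<eta> \<omega>) x) \<partial>P) + (\<integral>\<^sup>+\<omega>. v (x, add_point (\<eta> \<omega>) x) \<partial>P) \<partial>\<Lambda>)"
      by (rule nn_integral_add[symmetric]) measurable
    also have "\<dots> = (\<integral>\<^sup>+x. \<integral>\<^sup>+\<omega>. u (x, add_point (\<eta> \<omega>) x) + v (x, add_point (\<eta> \<omega>) x) \<partial>P \<partial>\<Lambda>)"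
      by (intro nn_integral_cong nn_integral_add[symmetric]) auto
    finally show ?case by (simp only: add.commute)
  next
    case (seq U)
    note [measurable] = seq(1)
    have mono: "U i z \<le> U j z" if "i \<le> j" for i j z
      using seq(4) that by (cases z) (auto simp: incseq_def le_fun_def)
    have "(\<integral>\<^sup>+\<omega>. \<integral>\<^sup>+x. (SUP i. U i (x, \<eta> \<omega>)) \<partial>\<eta> \<omega> \<partial>P) = (\<integral>\<^sup>+\<omega>. (SUP i. \<integral>\<^sup>+x. U i (x, \<eta> \<omega>) \<partial>\<eta> \<omega>) \<partial>P)"
      using m seq(1) mono
      by (intro nn_integral_cong nn_integral_monotone_convergence_SUP) (auto simp: incseq_def le_fun_def)
    also have "\<dots> = (SUP i. \<integral>\<^sup>+\<omega>. \<integral>\<^sup>+x. U i (x, \<eta> \<omega>) \<partial>\<eta> \<omega> \<partial>P)"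
      using k seq(1) mono
      by (intro nn_integral_monotone_convergence_SUP) (auto simp: incseq_def le_fun_def intro!: nn_integral_mono)
    also have "\<dots> = (SUP i. \<integral>\<^sup>+x. \<integral>\<^sup>+\<omega>. U i (x, add_point (\<eta> \<omega>) x) \<partial>P \<partial>\<Lambda>)"
      using seq(3) by simp
    also have "\<dots> = (\<integral>\<^sup>+x. (SUP i. \<integral>\<^sup>+\<omega>. U i (x, add_point (\<eta> \<omega>) x) \<partial>P) \<partial>\<Lambda>)"
      using mono
      by (intro nn_integral_monotone_convergence_SUP[symmetric])
         (auto simp: incseq_def le_fun_def intro!: nn_integral_mono)
    also have "\<dots> = (\<integral>\<^sup>+x. \<integral>\<^sup>+\<omega>. (SUP i. U i (x, add_point (\<eta> \<omega>) x)) \<partial>P \<partial>\<Lambda>)"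
      using mono
      by (intro nn_integral_cong nn_integral_monotone_convergence_SUP[symmetric])
         (auto simp: incseq_def le_fun_def)
    finally show ?case unfolding SUP_apply .
  qed
qed

end

section \<open>Resampling on bounded regions\<close>

context localized_space
begin

text \<open>Graph-measurability is separated here from the stopping property, since the regions to
  be resampled are complements of stopping sets rather than stopping sets.\<close>

definition measurable_region :: "('a measure \<Rightarrow> 'a set) \<Rightarrow> bool" where
  "measurable_region D \<longleftrightarrow> D \<in> space \<N> \<rightarrow> sets M \<and>
    {z \<in> space (M \<Otimes>\<^sub>M \<N>). fst z \<in> D (snd z)} \<in> sets (M \<Otimes>\<^sub>M \<N>)"

lemma measurable_region_sets: "measurable_region D \<Longrightarrow> \<mu> \<in> space \<N> \<Longrightarrow> D \<mu> \<in> sets M"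
  by (auto simp: measurable_region_def)

lemma measurable_region_graph:
  assumes D: "measurable_region D" and [measurable]: "f \<in> measurable X M" "g \<in> measurable X \<N>"
  shows "{x \<in> space X. f x \<in> D (g x)} \<in> sets X"
proof -
  let ?W = "{z \<in> space (M \<Otimes>\<^sub>M \<N>). fst z \<in> D (snd z)}"
  have "(\<lambda>x. (f x, g x)) -` ?W \<inter> space X \<in> sets X"
    using D by (intro measurable_sets[of _ X "M \<Otimes>\<^sub>M \<N>"]) (auto simp: measurable_region_def)
  also have "(\<lambda>x. (f x, g x)) -` ?W \<inter> space X = {x \<in> space X. f x \<in> D (g x)}"
    using measurable_space[OF assms(2)] measurable_space[OF assms(3)] by (auto simp: space_pair_measure)
  finally show ?thesis .
qed

lemma measurable_indicator_region:
  assumes "measurable_region D" "f \<in> measurable X M" "g \<in> measurable X \<N>"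
  shows "(\<lambda>x. indicator (D (g x)) (f x) :: ennreal) \<in> borel_measurable X"
proof -
  have "(\<lambda>x. indicator {x \<in> space X. f x \<in> D (g x)} x :: ennreal) \<in> borel_measurable X"
    using measurable_region_graph[OF assms] by simp
  then show ?thesis
    by (rule measurable_cong[THEN iffD1, rotated]) (auto split: split_indicator)
qed

lemma measurable_restr_region:
  assumes D: "measurable_region D" and [measurable]: "f \<in> measurable X \<N>" "g \<in> measurable X \<N>"
  shows "(\<lambda>x. restr (f x) (D (g x))) \<in> measurable X \<N>"
proof (rule measurable_restr)
  show "{z \<in> space (M \<Otimes>\<^sub>M X). fst z \<in> D (g (snd z))} \<in> sets (M \<Otimes>\<^sub>M X)"
    by (rule measurable_region_graph[OF D]) auto
qed (auto intro!: measurable_region_sets[OF D] measurable_space[OF assms(3)])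

lemma measurable_region_Diff:
  assumes D: "measurable_region D" and [measurable]: "C \<in> sets M"
  shows "measurable_region (\<lambda>\<mu>. C - D \<mu>)"
proof -
  have "{z \<in> space (M \<Otimes>\<^sub>M \<N>). fst z \<in> D (snd z)} \<in> sets (M \<Otimes>\<^sub>M \<N>)"
    using D by (simp add: measurable_region_def)
  then have "{z \<in> space (M \<Otimes>\<^sub>M \<N>). fst z \<in> C} - {z \<in> space (M \<Otimes>\<^sub>M \<N>). fst z \<in> D (snd z)}
      \<in> sets (M \<Otimes>\<^sub>M \<N>)" by measurable
  also have "{z \<in> space (M \<Otimes>\<^sub>M \<N>). fst z \<in> C} - {z \<in> space (M \<Otimes>\<^sub>M \<N>). fst z \<in> D (snd z)}
      = {z \<in> space (M \<Otimes>\<^sub>M \<N>). fst z \<in> C - D (snd z)}" by auto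
  finally show ?thesis
    using assms by (auto simp: measurable_region_def)
qed

lemma measurable_region_const: "C \<in> sets M \<Longrightarrow> measurable_region (\<lambda>_. C)"
  by (auto simp: measurable_region_def)

lemma restr_eq_self:
  assumes "\<mu> \<in> space \<N>" "D \<in> sets M" "emeasure \<mu> D = 0"
  shows "restr \<mu> (space M - D) = \<mu>"
proof (rule counting_eqI)
  fix C assume C: "C \<in> sets M"
  have "emeasure \<mu> (C \<inter> (space M - D)) = emeasure \<mu> (C - D)"
    using sets.sets_into_space[OF C] by (intro arg_cong2[where f = emeasure]) auto
  also have "\<dots> = emeasure \<mu> C"
    using assms C by (intro emeasure_Diff_null_set) (auto simp: null_sets_def sets_counting)
  finally show "emeasure (restr \<mu> (space M - D)) C = emeasure \<mu> C"
    using assms C by (simp add: emeasure_restr_counting)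
qed (use assms in auto)

lemma restr_eq_null:
  assumes "\<mu> \<in> space \<N>" "D \<in> sets M" "emeasure \<mu> D = 0"
  shows "restr \<mu> D = null_measure M"
proof (rule counting_eqI)
  fix C assume C: "C \<in> sets M"
  have "emeasure \<mu> (C \<inter> D) \<le> emeasure \<mu> D"
    using assms C by (intro emeasure_mono) (auto simp: sets_counting)
  then show "emeasure (restr \<mu> D) C = emeasure (null_measure M) C"
    using assms C by (simp add: emeasure_restr_counting)
qed (use assms in auto)

lemma add_null: "\<mu> \<in> space \<N> \<Longrightarrow> add_measure \<mu> (null_measure M) = \<mu>"
  by (rule counting_eqI) (auto simp: emeasure_add_counting)

lemma add_point_assoc:
  "\<zeta> \<in> space \<N> \<Longrightarrow> \<mu> \<in> space \<N> \<Longrightarrow> x \<in> space M \<Longrightarrow>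
    add_measure \<zeta> (add_point \<mu> x) = add_point (add_measure \<zeta> \<mu>) x"
  by (rule counting_eqI) (auto simp: emeasure_add_counting add.assoc)

lemma restr_add_point:
  assumes "\<mu> \<in> space \<N>" "x \<in> space M" "D \<in> sets M"
  shows "restr (add_point \<mu> x) D = (if x \<in> D then add_point (restr \<mu> D) x else restr \<mu> D)"
  using assms
  by (intro counting_eqI)
     (auto simp: emeasure_add_counting emeasure_restr_counting indicator_def)

end

section \<open>The insertion operator and the expansion by the number of points\<close>

context poisson
begin

text \<open>The two cases of the disjunction stand for insertion and removal: a point put into the
  region does not move it, and neither does taking away a point that the enlarged configuration has
  in its region. The bound \<open>Bs n\<close> keeps the count and the intensity of the region
  finite.\<close>

definition stable_region :: "nat \<Rightarrow> ('a measure \<Rightarrow> 'a set) \<Rightarrow> bool" where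
  "stable_region n D \<longleftrightarrow> measurable_region D \<and> (\<forall>\<mu>\<in>space \<N>. D \<mu> \<subseteq> Bs n \<and>
    (\<forall>x\<in>space M. x \<in> D \<mu> \<or> x \<in> D (add_point \<mu> x) \<longrightarrow> D (add_point \<mu> x) = D \<mu>))"

text \<open>The operator K of the overview, with the region read off before the insertion;
  \<open>insert_exp\<close> is its exponential series. Both see the Poisson process only through
  \<open>\<Lambda>\<close>, from which uniqueness of the law will follow.\<close>

definition insert_op :: "('a measure \<Rightarrow> 'a set) \<Rightarrow> ('a measure \<Rightarrow> ennreal) \<Rightarrow> 'a measure \<Rightarrow> ennreal" where
  "insert_op D F \<mu> = (\<integral>\<^sup>+x. indicator (D \<mu>) x * F (add_point \<mu> x) \<partial>\<Lambda>)"

definition insert_exp :: "('a measure \<Rightarrow> 'a set) \<Rightarrow> ('a measure \<Rightarrow> ennreal) \<Rightarrow> 'a measure \<Rightarrow> ennreal" where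
  "insert_exp D F \<mu> = (\<Sum>k. (insert_op D ^^ k) F \<mu> / of_nat (fact k))"

definition count_ind :: "('a measure \<Rightarrow> 'a set) \<Rightarrow> nat \<Rightarrow> 'a measure \<Rightarrow> ennreal" where
  "count_ind D k \<mu> = indicator {of_nat k} (emeasure \<mu> (D \<mu>))"

lemma stable_regionD:
  assumes "stable_region n D"
  shows "measurable_region D"
    and "\<mu> \<in> space \<N> \<Longrightarrow> D \<mu> \<in> sets M" "\<mu> \<in> space \<N> \<Longrightarrow> D \<mu> \<subseteq> Bs n"
    and "\<mu> \<in> space \<N> \<Longrightarrow> x \<in> space M \<Longrightarrow> x \<in> D \<mu> \<or> x \<in> D (add_point \<mu> x) \<Longrightarrow> D (add_point \<mu> x) = D \<mu>"
  using assms measurable_region_sets[of D] unfolding stable_region_def by blast+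

lemma stable_region_const: "C \<in> sets M \<Longrightarrow> C \<subseteq> Bs n \<Longrightarrow> stable_region n (\<lambda>_. C)"
  by (auto simp: stable_region_def measurable_region_const)

text \<open>Region and base measure may differ on the two sides: this serves both to freeze the
  region at its initial value and to compare the operator at two related measures.\<close>

lemma insert_op_cong:
  assumes "D \<mu> = E \<nu>" "\<And>x. x \<in> space M \<Longrightarrow> x \<in> D \<mu> \<Longrightarrow> F (add_point \<mu> x) = G (add_point \<nu> x)"
  shows "insert_op D F \<mu> = insert_op E G \<nu>"
  unfolding insert_op_def assms(1)[symmetric]
  using assms(2) by (intro nn_integral_cong) (auto split: split_indicator)

lemma measurable_insert_op:
  assumes D: "measurable_region D" and [measurable]: "F \<in> borel_measurable \<N>"
  shows "insert_op D F \<in> borel_measurable \<N>"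
proof -
  have [measurable]: "(\<lambda>z. indicator (D (fst z)) (snd z) :: ennreal) \<in> borel_measurable (\<N> \<Otimes>\<^sub>M \<Lambda>)"
    by (rule measurable_indicator_region[OF D]) auto
  have "(\<lambda>\<mu>. \<integral>\<^sup>+x. indicator (D (fst (\<mu>, x))) (snd (\<mu>, x)) * F (add_point \<mu> x) \<partial>\<Lambda>) \<in> borel_measurable \<N>"
    by measurable
  then show ?thesis by (simp add: insert_op_def[abs_def])
qed

lemma measurable_insert_op_pow:
  "measurable_region D \<Longrightarrow> F \<in> borel_measurable \<N> \<Longrightarrow> (insert_op D ^^ k) F \<in> borel_measurable \<N>"
  by (induction k) (auto intro: measurable_insert_op)

lemma measurable_region_count:
  assumes D: "measurable_region D"
  shows "(\<lambda>\<mu>. emeasure \<mu> (D \<mu>)) \<in> borel_measurable \<N>"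
proof -
  have "(\<lambda>\<mu>. emeasure \<mu> {x \<in> space M. (x, \<mu>) \<in> {z \<in> space (M \<Otimes>\<^sub>M \<N>). fst z \<in> D (snd z)}}) \<in> borel_measurable \<N>"
    using D by (intro measurable_kernel_emeasure measurable_ident_sets refl) (simp add: measurable_region_def)
  then show ?thesis
    by (rule measurable_cong[THEN iffD1, rotated])
       (use measurable_region_sets[OF D] sets.sets_into_space in
         \<open>fastforce intro!: arg_cong2[where f = emeasure] simp: space_pair_measure\<close>)
qed

lemma measurable_count_ind:
  "measurable_region D \<Longrightarrow> count_ind D k \<in> borel_measurable \<N>"
  unfolding count_ind_def[abs_def]
  by (intro measurable_compose[OF measurable_region_count] borel_measurable_indicator) auto

lemma stable_count_add_point:
  assumes D: "stable_region n D" and "\<mu> \<in> space \<N>" "x \<in> space M" "x \<in> D \<mu>"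
  shows "count_ind D (Suc k) (add_point \<mu> x) = count_ind D k \<mu>"
proof -
  have "emeasure (add_point \<mu> x) (D (add_point \<mu> x)) = emeasure \<mu> (D \<mu>) + 1"
    using assms stable_regionD(4)[OF D, of \<mu> x] stable_regionD(2)[OF D, of \<mu>]
    by (simp add: emeasure_add_point)
  moreover have "emeasure \<mu> (D \<mu>) + 1 = of_nat (Suc k) \<longleftrightarrow> emeasure \<mu> (D \<mu>) = of_nat k"
    using ennreal_add_left_cancel[of 1 "emeasure \<mu> (D \<mu>)" "of_nat k"] by (simp add: add.commute)
  ultimately show ?thesis by (simp add: count_ind_def indicator_def)
qed

text \<open>The Mecke equation evaluates the region at the enlarged configuration; stability allows
  reading it off at the original one, as \<open>insert_op\<close> does.\<close>

lemma mecke_region: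
  assumes D: "stable_region n D" and F [measurable]: "F \<in> borel_measurable \<N>"
  shows "(\<integral>\<^sup>+\<omega>. emeasure (\<eta> \<omega>) (D (\<eta> \<omega>)) * F (\<eta> \<omega>) \<partial>P) = (\<integral>\<^sup>+\<omega>. insert_op D F (\<eta> \<omega>) \<partial>P)"
proof -
  note ind = measurable_indicator_region[OF stable_regionD(1)[OF D]]
  have [measurable]: "(\<lambda>z. indicator (D (snd z)) (fst z) :: ennreal) \<in> borel_measurable (M \<Otimes>\<^sub>M \<N>)"
    by (rule ind) auto
  have [measurable]: "(\<lambda>z. indicator (D (\<eta> (snd z))) (fst z) :: ennreal) \<in> borel_measurable (\<Lambda> \<Otimes>\<^sub>M P)"
    by (rule ind) auto
  have "(\<integral>\<^sup>+\<omega>. emeasure (\<eta> \<omega>) (D (\<eta> \<omega>)) * F (\<eta> \<omega>) \<partial>P)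
      = (\<integral>\<^sup>+\<omega>. \<integral>\<^sup>+x. indicator (D (\<eta> \<omega>)) x * F (\<eta> \<omega>) \<partial>\<eta> \<omega> \<partial>P)"
  proof (intro nn_integral_cong)
    fix \<omega> assume "\<omega> \<in> space P"
    then have [measurable]: "D (\<eta> \<omega>) \<in> sets (\<eta> \<omega>)"
      using stable_regionD(2)[OF D, of "\<eta> \<omega>"] by (simp add: sets_counting)
    show "emeasure (\<eta> \<omega>) (D (\<eta> \<omega>)) * F (\<eta> \<omega>) = (\<integral>\<^sup>+x. indicator (D (\<eta> \<omega>)) x * F (\<eta> \<omega>) \<partial>\<eta> \<omega>)"
      by (subst nn_integral_multc) auto
  qed
  also have "\<dots> = (\<integral>\<^sup>+x. \<integral>\<^sup>+\<omega>. indicator (D (add_point (\<eta> \<omega>) x)) x * F (add_point (\<eta> \<omega>) x) \<partial>P \<partial>\<Lambda>)"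
    using mecke[of "\<lambda>z. indicator (D (snd z)) (fst z) * F (snd z)"] by simp
  also have "\<dots> = (\<integral>\<^sup>+x. \<integral>\<^sup>+\<omega>. indicator (D (\<eta> \<omega>)) x * F (add_point (\<eta> \<omega>) x) \<partial>P \<partial>\<Lambda>)"
  proof (intro nn_integral_cong)
    fix x \<omega> assume "x \<in> space \<Lambda>" "\<omega> \<in> space P"
    then have "x \<in> D (add_point (\<eta> \<omega>) x) \<longleftrightarrow> x \<in> D (\<eta> \<omega>)"
      using stable_regionD(4)[OF D, of "\<eta> \<omega>" x] by auto
    then show "indicator (D (add_point (\<eta> \<omega>) x)) x * F (add_point (\<eta> \<omega>) x)
        = indicator (D (\<eta> \<omega>)) x * F (add_point (\<eta> \<omega>) x)" by (simp add: indicator_def)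
  qed
  also have "\<dots> = (\<integral>\<^sup>+\<omega>. insert_op D F (\<eta> \<omega>) \<partial>P)"
    unfolding insert_op_def
    by (rule \<Lambda>P.Fubini'[symmetric]) (simp add: case_prod_beta)
  finally show ?thesis .
qed

text \<open>On the event of \<open>k + 1\<close> points, the factor \<open>k + 1\<close> is the
  count itself. The Mecke equation trades this factor for an insertion, which lowers the required
  number of points by one and turns \<open>F\<close> into \<open>insert_op D F\<close>; hence
  \<open>F\<close> varies in the induction.\<close>

lemma count_expansion:
  assumes D: "stable_region n D" and "F \<in> borel_measurable \<N>"
  shows "of_nat (fact k) * (\<integral>\<^sup>+\<omega>. count_ind D k (\<eta> \<omega>) * F (\<eta> \<omega>) \<partial>P) =
    (\<integral>\<^sup>+\<omega>. count_ind D 0 (\<eta> \<omega>) * (insert_op D ^^ k) F (\<eta> \<omega>) \<partial>P)"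
  using assms(2)
proof (induction k arbitrary: F)
  case 0
  then show ?case by simp
next
  case (Suc k)
  note [measurable] = Suc.prems measurable_count_ind[OF stable_regionD(1)[OF D]]
    measurable_insert_op[OF stable_regionD(1)[OF D]]
  have "of_nat (Suc k) * (\<integral>\<^sup>+\<omega>. count_ind D (Suc k) (\<eta> \<omega>) * F (\<eta> \<omega>) \<partial>P)
      = (\<integral>\<^sup>+\<omega>. of_nat (Suc k) * (count_ind D (Suc k) (\<eta> \<omega>) * F (\<eta> \<omega>)) \<partial>P)"
    by (rule nn_integral_cmult[symmetric]) measurable
  also have "\<dots> = (\<integral>\<^sup>+\<omega>. emeasure (\<eta> \<omega>) (D (\<eta> \<omega>)) * (count_ind D (Suc k) (\<eta> \<omega>) * F (\<eta> \<omega>)) \<partial>P)"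
    by (intro nn_integral_cong) (auto simp: count_ind_def split: split_indicator)
  also have "\<dots> = (\<integral>\<^sup>+\<omega>. insert_op D (\<lambda>\<mu>. count_ind D (Suc k) \<mu> * F \<mu>) (\<eta> \<omega>) \<partial>P)"
    by (rule mecke_region[OF D]) measurable
  also have "\<dots> = (\<integral>\<^sup>+\<omega>. count_ind D k (\<eta> \<omega>) * insert_op D F (\<eta> \<omega>) \<partial>P)"
  proof (intro nn_integral_cong)
    fix \<omega> assume \<omega>: "\<omega> \<in> space P"
    have [measurable]: "D (\<eta> \<omega>) \<in> sets M" using \<omega> by (intro stable_regionD(2)[OF D]) simp
    have [measurable]: "(\<lambda>x. add_point (\<eta> \<omega>) x) \<in> measurable M \<N>"
      using \<omega> by (intro measurable_add_point) auto
    have "insert_op D (\<lambda>\<mu>. count_ind D (Suc k) \<mu> * F \<mu>) (\<eta> \<omega>)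
        = (\<integral>\<^sup>+x. count_ind D k (\<eta> \<omega>) * (indicator (D (\<eta> \<omega>)) x * F (add_point (\<eta> \<omega>) x)) \<partial>\<Lambda>)"
      unfolding insert_op_def using \<omega>
      by (intro nn_integral_cong) (auto simp: stable_count_add_point[OF D] split: split_indicator)
    also have "\<dots> = count_ind D k (\<eta> \<omega>) * insert_op D F (\<eta> \<omega>)"
      unfolding insert_op_def by (rule nn_integral_cmult) measurable
    finally show "insert_op D (\<lambda>\<mu>. count_ind D (Suc k) \<mu> * F \<mu>) (\<eta> \<omega>)
      = count_ind D k (\<eta> \<omega>) * insert_op D F (\<eta> \<omega>)" .
  qed
  finally have *: "of_nat (Suc k) * (\<integral>\<^sup>+\<omega>. count_ind D (Suc k) (\<eta> \<omega>) * F (\<eta> \<omega>) \<partial>P)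
      = (\<integral>\<^sup>+\<omega>. count_ind D k (\<eta> \<omega>) * insert_op D F (\<eta> \<omega>) \<partial>P)" .
  have "of_nat (fact (Suc k)) * (\<integral>\<^sup>+\<omega>. count_ind D (Suc k) (\<eta> \<omega>) * F (\<eta> \<omega>) \<partial>P)
      = of_nat (fact k) * (of_nat (Suc k) * (\<integral>\<^sup>+\<omega>. count_ind D (Suc k) (\<eta> \<omega>) * F (\<eta> \<omega>) \<partial>P))"
    by (simp only: fact_Suc of_nat_mult of_nat_id mult_ac)
  also have "\<dots> = (\<integral>\<^sup>+\<omega>. count_ind D 0 (\<eta> \<omega>) * (insert_op D ^^ k) (insert_op D F) (\<eta> \<omega>) \<partial>P)"
    unfolding * by (rule Suc.IH) measurable
  finally show ?case by (simp add: funpow_swap1)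
qed

text \<open>Since the region lies in \<open>Bs n\<close>, its count is a natural number, so the
  events of exactly \<open>k\<close> points partition the space and the identities for fixed
  \<open>k\<close> can be summed.\<close>

lemma expansion:
  assumes D: "stable_region n D" and F [measurable]: "F \<in> borel_measurable \<N>"
  shows "(\<integral>\<^sup>+\<omega>. F (\<eta> \<omega>) \<partial>P) = (\<integral>\<^sup>+\<omega>. count_ind D 0 (\<eta> \<omega>) * insert_exp D F (\<eta> \<omega>) \<partial>P)"
proof -
  note [measurable] = measurable_count_ind[OF stable_regionD(1)[OF D]]
    measurable_insert_op_pow[OF stable_regionD(1)[OF D]]
  have "(\<integral>\<^sup>+\<omega>. F (\<eta> \<omega>) \<partial>P) = (\<integral>\<^sup>+\<omega>. (\<Sum>k. count_ind D k (\<eta> \<omega>) * F (\<eta> \<omega>)) \<partial>P)"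
  proof (intro nn_integral_cong)
    fix \<omega> assume \<omega>: "\<omega> \<in> space P"
    then obtain j :: nat where j: "emeasure (\<eta> \<omega>) (D (\<eta> \<omega>)) = of_nat j"
      using counting_bounded[of "\<eta> \<omega>" "D (\<eta> \<omega>)" n] stable_regionD(2,3)[OF D, of "\<eta> \<omega>"] by auto
    have "(\<Sum>k. count_ind D k (\<eta> \<omega>)) = (\<Sum>k\<in>{j}. count_ind D k (\<eta> \<omega>))"
      by (rule suminf_finite) (auto simp: count_ind_def j)
    then show "F (\<eta> \<omega>) = (\<Sum>k. count_ind D k (\<eta> \<omega>) * F (\<eta> \<omega>))"
      by (simp add: count_ind_def j)
  qed
  also have "\<dots> = (\<Sum>k. \<integral>\<^sup>+\<omega>. count_ind D k (\<eta> \<omega>) * F (\<eta> \<omega>) \<partial>P)"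
    by (rule nn_integral_suminf) measurable
  also have "\<dots> = (\<Sum>k. \<integral>\<^sup>+\<omega>. count_ind D 0 (\<eta> \<omega>) * (insert_op D ^^ k) F (\<eta> \<omega>) / of_nat (fact k) \<partial>P)"
  proof (intro suminf_cong)
    fix k
    have "(\<integral>\<^sup>+\<omega>. count_ind D k (\<eta> \<omega>) * F (\<eta> \<omega>) \<partial>P)
        = (\<integral>\<^sup>+\<omega>. count_ind D k (\<eta> \<omega>) * F (\<eta> \<omega>) \<partial>P) * of_nat (fact k) / of_nat (fact k)"
      by (rule mult_divide_eq_ennreal[symmetric]) auto
    also have "\<dots> = (\<integral>\<^sup>+\<omega>. count_ind D 0 (\<eta> \<omega>) * (insert_op D ^^ k) F (\<eta> \<omega>) \<partial>P) / of_nat (fact k)"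
      using count_expansion[OF D F, of k] by (simp add: mult.commute)
    also have "\<dots> = (\<integral>\<^sup>+\<omega>. count_ind D 0 (\<eta> \<omega>) * (insert_op D ^^ k) F (\<eta> \<omega>) / of_nat (fact k) \<partial>P)"
      by (rule nn_integral_divide[symmetric]) measurable
    finally show "(\<integral>\<^sup>+\<omega>. count_ind D k (\<eta> \<omega>) * F (\<eta> \<omega>) \<partial>P) = \<dots>" .
  qed
  also have "\<dots> = (\<integral>\<^sup>+\<omega>. (\<Sum>k. count_ind D 0 (\<eta> \<omega>) * (insert_op D ^^ k) F (\<eta> \<omega>) / of_nat (fact k)) \<partial>P)"
    by (rule nn_integral_suminf[symmetric]) measurable
  also have "\<dots> = (\<integral>\<^sup>+\<omega>. count_ind D 0 (\<eta> \<omega>) * insert_exp D F (\<eta> \<omega>) \<partial>P)"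
    unfolding insert_exp_def ennreal_suminf_cmult[symmetric] by (simp add: ennreal_times_divide)
  finally show ?thesis .
qed

text \<open>All points inserted by the iterated operator lie in \<open>D \<mu>\<close>, and such
  insertions leave the region unchanged. Freezing it makes the formula for constant regions
  applicable.\<close>

lemma insert_op_pow_cong:
  assumes D: "stable_region n D" and "\<mu> \<in> space \<N>"
  shows "(insert_op D ^^ k) F \<mu> = (insert_op (\<lambda>_. D \<mu>) ^^ k) F \<mu>"
  using assms(2)
proof (induction k arbitrary: \<mu>)
  case (Suc k)
  have "(insert_op D ^^ k) F (add_point \<mu> x) = (insert_op (\<lambda>_. D \<mu>) ^^ k) F (add_point \<mu> x)"
    if "x \<in> D \<mu>" "x \<in> space M" for x
    using Suc.IH[of "add_point \<mu> x"] stable_regionD(4)[OF D Suc.prems that(2)] that Suc.prems by simp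
  then show ?case
    unfolding funpow.simps o_apply by (intro insert_op_cong) auto
qed simp

text \<open>The expansion is applied to the functional that adds \<open>\<zeta>\<close> to the part
  in \<open>C\<close>. Only configurations without points in \<open>C\<close> contribute, and for
  them that part is null, so the series is evaluated at \<open>\<zeta>\<close>; the exponential
  factor is the void probability of \<open>C\<close>.\<close>

lemma expansion_const:
  assumes C [measurable]: "C \<in> sets M" and bounded: "C \<subseteq> Bs n"
    and \<zeta> [measurable]: "\<zeta> \<in> space \<N>" and F [measurable]: "F \<in> borel_measurable \<N>"
  shows "(\<integral>\<^sup>+\<omega>. F (add_measure \<zeta> (restr (\<eta> \<omega>) C)) \<partial>P) =
    ennreal (exp (- measure \<Lambda> C)) * insert_exp (\<lambda>_. C) F \<zeta>"
proof -
  let ?D = "\<lambda>_. C"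
  have D: "stable_region n ?D" using C bounded by (rule stable_region_const)
  \<comment> \<open>Insertion commutes with restricting to \<open>C\<close> and adding
    \<open>\<zeta>\<close>, because the inserted points lie in \<open>C\<close> and survive the
    restriction.\<close>
  have pow: "(insert_op ?D ^^ k) (\<lambda>\<mu>. F (add_measure \<zeta> (restr \<mu> C))) \<mu>
      = (insert_op ?D ^^ k) F (add_measure \<zeta> (restr \<mu> C))" if "\<mu> \<in> space \<N>" for k \<mu>
    using that
  proof (induction k arbitrary: \<mu>)
    case (Suc k)
    then show ?case
      unfolding funpow.simps o_apply
      by (intro insert_op_cong) (auto simp: restr_add_point add_point_assoc \<zeta>)
  qed simp
  have "(\<integral>\<^sup>+\<omega>. F (add_measure \<zeta> (restr (\<eta> \<omega>) C)) \<partial>P)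
      = (\<integral>\<^sup>+\<omega>. count_ind ?D 0 (\<eta> \<omega>) * insert_exp ?D (\<lambda>\<mu>. F (add_measure \<zeta> (restr \<mu> C))) (\<eta> \<omega>) \<partial>P)"
    by (rule expansion[OF D]) measurable
  also have "\<dots> = (\<integral>\<^sup>+\<omega>. insert_exp ?D F \<zeta> * indicator {\<omega> \<in> space P. emeasure (\<eta> \<omega>) C = of_nat 0} \<omega> \<partial>P)"
    by (intro nn_integral_cong)
       (auto simp: count_ind_def insert_exp_def pow restr_eq_null add_null \<zeta> split: split_indicator)
  also have "\<dots> = insert_exp ?D F \<zeta> * emeasure P {\<omega> \<in> space P. emeasure (\<eta> \<omega>) C = of_nat 0}"
    by (rule nn_integral_cmult_indicator) measurable
  also have "emeasure P {\<omega> \<in> space P. emeasure (\<eta> \<omega>) C = of_nat 0} = ennreal (exp (- measure \<Lambda> C))"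
    unfolding emeasure_eq_measure poisson_count[OF C Lambda_bounded[OF C bounded]] by simp
  finally show ?thesis by (simp add: mult.commute)
qed

text \<open>Let \<open>T\<close> be \<open>F\<close> averaged over the copy. On the event of no
  points in the region, \<open>T\<close> is exp(-\<Lambda>(D)) times the series of \<open>F\<close>
  by \<open>expansion_const\<close>, while the series of \<open>T\<close> is exp(\<Lambda>(D)) times
  \<open>T\<close>. So both series agree there, and expanding \<open>F\<close> and contracting
  \<open>T\<close> gives equal expectations.\<close>

theorem resampling:
  assumes D: "stable_region n D" and F [measurable]: "F \<in> borel_measurable \<N>"
  shows "(\<integral>\<^sup>+\<omega>. F (\<eta> \<omega>) \<partial>P) =
    (\<integral>\<^sup>+\<omega>. \<integral>\<^sup>+\<omega>'. F (add_measure (restr (\<eta> \<omega>) (space M - D (\<eta> \<omega>))) (restr (\<eta> \<omega>') (D (\<eta> \<omega>)))) \<partial>P \<partial>P)"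
proof -
  define T where
    "T \<mu> = (\<integral>\<^sup>+\<omega>. F (add_measure (restr \<mu> (space M - D \<mu>)) (restr (\<eta> \<omega>) (D \<mu>))) \<partial>P)" for \<mu>
  note reg = stable_regionD(1)[OF D]
  note reg' = measurable_region_Diff[OF reg sets.top]
  have T [measurable]: "T \<in> borel_measurable \<N>"
  proof -
    have [measurable]: "(\<lambda>z. restr (fst z) (space M - D (fst z))) \<in> measurable (\<N> \<Otimes>\<^sub>M P) \<N>"
      by (rule measurable_restr_region[OF reg']) auto
    have [measurable]: "(\<lambda>z. restr (\<eta> (snd z)) (D (fst z))) \<in> measurable (\<N> \<Otimes>\<^sub>M P) \<N>"
      by (rule measurable_restr_region[OF reg]) auto
    have "(\<lambda>\<mu>. \<integral>\<^sup>+\<omega>. F (add_measure (restr (fst (\<mu>, \<omega>)) (space M - D (fst (\<mu>, \<omega>))))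
        (restr (\<eta> (snd (\<mu>, \<omega>))) (D (fst (\<mu>, \<omega>))))) \<partial>P) \<in> borel_measurable \<N>"
      by measurable
    then show ?thesis by (simp add: T_def[abs_def])
  qed
  \<comment> \<open>\<open>T\<close> discards the points of \<open>\<mu>\<close> in the region, so
    an insertion there, which also keeps the region, is invisible to it.\<close>
  have T_add: "T (add_point \<mu> x) = T \<mu>" if "\<mu> \<in> space \<N>" "x \<in> space M" "x \<in> D \<mu>" for \<mu> x
    using that stable_regionD(2)[OF D, of \<mu>] stable_regionD(4)[OF D, of \<mu> x]
    by (simp add: T_def restr_add_point)
  have T_pow: "(insert_op D ^^ k) T \<mu> = emeasure \<Lambda> (D \<mu>) ^ k * T \<mu>" if "\<mu> \<in> space \<N>" for k \<mu>
    using that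
  proof (induction k arbitrary: \<mu>)
    case (Suc k)
    then have "(insert_op D ^^ Suc k) T \<mu> = (\<integral>\<^sup>+x. indicator (D \<mu>) x * (emeasure \<Lambda> (D \<mu>) ^ k * T \<mu>) \<partial>\<Lambda>)"
      unfolding funpow.simps o_apply insert_op_def[of D "(insert_op D ^^ k) T" \<mu>]
      using stable_regionD(4)[OF D Suc.prems _ disjI1]
      by (intro nn_integral_cong) (auto simp: T_add split: split_indicator)
    also have "\<dots> = emeasure \<Lambda> (D \<mu>) ^ Suc k * T \<mu>"
      using stable_regionD(2)[OF D, of \<mu>] Suc by (subst nn_integral_multc) (auto simp: mult.assoc)
    finally show ?case .
  qed simp
  have T_exp: "insert_exp D T \<mu> = ennreal (exp (measure \<Lambda> (D \<mu>))) * T \<mu>" if \<mu>: "\<mu> \<in> space \<N>" for \<mu>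
  proof -
    let ?l = "measure \<Lambda> (D \<mu>)"
    have L: "emeasure \<Lambda> (D \<mu>) = ennreal ?l"
      using Lambda_bounded[OF stable_regionD(2,3)[OF D \<mu>]] by (simp add: emeasure_eq_ennreal_measure)
    have "insert_exp D T \<mu> = (\<Sum>k. ennreal (?l ^ k / fact k) * T \<mu>)"
      unfolding insert_exp_def T_pow[OF \<mu>] L
    proof (intro suminf_cong)
      fix k
      have "ennreal ?l ^ k / of_nat (fact k) = ennreal (?l ^ k / fact k)"
        by (simp add: ennreal_power ennreal_of_nat_eq_real_of_nat divide_ennreal)
      then show "ennreal ?l ^ k * T \<mu> / of_nat (fact k) = ennreal (?l ^ k / fact k) * T \<mu>"
        by (metis ennreal_times_divide mult.commute)
    qed
    also have "\<dots> = (\<Sum>k. ennreal (?l ^ k / fact k)) * T \<mu>" by (rule ennreal_suminf_multc)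
    also have "(\<Sum>k. ennreal (?l ^ k / fact k)) = ennreal (exp ?l)"
      using exp_converges[of ?l]
      by (intro sums_unique[symmetric]) (subst sums_ennreal, auto simp: field_simps)
    finally show ?thesis .
  qed
  have T_void: "count_ind D 0 \<mu> * insert_exp D T \<mu> = count_ind D 0 \<mu> * insert_exp D F \<mu>"
    if \<mu>: "\<mu> \<in> space \<N>" for \<mu>
  proof (cases "emeasure \<mu> (D \<mu>) = 0")
    case True
    \<comment> \<open>Without points in the region, restricting to its complement changes nothing,
      so \<open>\<mu>\<close> itself can serve as the fixed part \<open>\<zeta>\<close>.\<close>
    have "T \<mu> = (\<integral>\<^sup>+\<omega>. F (add_measure \<mu> (restr (\<eta> \<omega>) (D \<mu>))) \<partial>P)"
      using True stable_regionD(2)[OF D \<mu>] \<mu> by (simp add: T_def restr_eq_self)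
    also have "\<dots> = ennreal (exp (- measure \<Lambda> (D \<mu>))) * insert_exp (\<lambda>_. D \<mu>) F \<mu>"
      using stable_regionD(2,3)[OF D \<mu>] \<mu> by (intro expansion_const) auto
    also have "insert_exp (\<lambda>_. D \<mu>) F \<mu> = insert_exp D F \<mu>"
      unfolding insert_exp_def insert_op_pow_cong[OF D \<mu>] ..
    finally have "insert_exp D T \<mu> = ennreal (exp (measure \<Lambda> (D \<mu>)) * exp (- measure \<Lambda> (D \<mu>))) * insert_exp D F \<mu>"
      by (simp add: T_exp[OF \<mu>] ennreal_mult mult.assoc)
    then show ?thesis by (simp add: exp_minus)
  qed (simp add: count_ind_def)
  have "(\<integral>\<^sup>+\<omega>. F (\<eta> \<omega>) \<partial>P) = (\<integral>\<^sup>+\<omega>. count_ind D 0 (\<eta> \<omega>) * insert_exp D F (\<eta> \<omega>) \<partial>P)"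
    by (rule expansion[OF D F])
  also have "\<dots> = (\<integral>\<^sup>+\<omega>. count_ind D 0 (\<eta> \<omega>) * insert_exp D T (\<eta> \<omega>) \<partial>P)"
    by (intro nn_integral_cong) (simp add: T_void)
  also have "\<dots> = (\<integral>\<^sup>+\<omega>. T (\<eta> \<omega>) \<partial>P)"
    by (rule expansion[OF D T, symmetric])
  finally show ?thesis by (simp add: T_def)
qed

end

section \<open>Stopping sets\<close>

context localized_space
begin

text \<open>Events seen through the windows \<open>Bs n\<close> generate, since the mass of a set is
  the supremum of its masses within the windows, and they are intersection-stable, since the windows
  are nested.\<close>

lemma measure_eqI_restr_Bs:
  assumes Q: "sets Q = sets \<N>" "sets Q' = sets \<N>" and fin: "emeasure Q (space \<N>) \<noteq> \<infinity>"
    and eq: "\<And>n A. A \<in> sets \<N> \<Longrightarrow>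
      emeasure Q {\<mu> \<in> space \<N>. restr \<mu> (Bs n) \<in> A} = emeasure Q' {\<mu> \<in> space \<N>. restr \<mu> (Bs n) \<in> A}"
  shows "Q = Q'"
proof -
  define E where "E = {{\<mu> \<in> space \<N>. restr \<mu> (Bs n) \<in> A} | n A. A \<in> sets \<N>}"
  have sub: "E \<subseteq> Pow (space \<N>)" by (auto simp: E_def)
  \<comment> \<open>For \<open>n \<le> m\<close> the restriction to the smaller window factors
    through the larger one, so both events are events in the window \<open>Bs m\<close>.\<close>
  have Int: "a \<inter> b \<in> E"
    if a: "a = {\<mu> \<in> space \<N>. restr \<mu> (Bs n) \<in> A}" and b: "b = {\<mu> \<in> space \<N>. restr \<mu> (Bs m) \<in> B}"
      and [measurable]: "A \<in> sets \<N>" "B \<in> sets \<N>" and "n \<le> m" for a b n m A B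
  proof -
    have "restr (restr \<mu> (Bs m)) (Bs n) = restr \<mu> (Bs n)" if "\<mu> \<in> space \<N>" for \<mu>
      using that incseqD[OF incseq_Bs \<open>n \<le> m\<close>]
      by (intro counting_eqI) (auto simp: emeasure_restr_counting Int_assoc Int_absorb2)
    then have "a \<inter> b = {\<mu> \<in> space \<N>. restr \<mu> (Bs m) \<in> {\<nu> \<in> space \<N>. restr \<nu> (Bs n) \<in> A} \<inter> B}"
      unfolding a b by auto
    moreover have "{\<nu> \<in> space \<N>. restr \<nu> (Bs n) \<in> A} \<inter> B \<in> sets \<N>" by measurable
    ultimately show ?thesis unfolding E_def by blast
  qed
  have stable: "Int_stable E"
  proof (rule Int_stableI)
    fix a b assume "a \<in> E" "b \<in> E"
    then obtain n A m B where *: "a = {\<mu> \<in> space \<N>. restr \<mu> (Bs n) \<in> A}" "b = {\<mu> \<in> space \<N>. restr \<mu> (Bs m) \<in> B}"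
      "A \<in> sets \<N>" "B \<in> sets \<N>" unfolding E_def by auto
    show "a \<inter> b \<in> E"
      using Int[OF *] Int[OF *(2,1,4,3)] linear[of n m] by (auto simp: Int_commute)
  qed
  have gen: "sets \<N> = sigma_sets (space \<N>) E"
  proof
    have [simp]: "space (sigma (space \<N>) E) = space \<N>" "sets (sigma (space \<N>) E) = sigma_sets (space \<N>) E"
      using sub by (simp_all add: space_measure_of sets_measure_of)
    \<comment> \<open>One inclusion of sigma-fields is stated as measurability of the identity,
      which reduces it to the evaluation maps.\<close>
    have "(\<lambda>\<mu>. \<mu>) \<in> measurable (sigma (space \<N>) E) \<N>"
    proof (rule measurable_counting_algebraI)
      fix C assume C [measurable]: "C \<in> sets M"
      have "(\<lambda>\<mu>. emeasure (restr \<mu> (Bs n)) C) \<in> borel_measurable (sigma (space \<N>) E)" for n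
      proof (rule measurableI)
        fix S :: "ennreal set" assume S: "S \<in> sets borel"
        have "{\<nu> \<in> space \<N>. emeasure \<nu> C \<in> S} \<in> sets \<N>" using S by measurable
        then have "{\<mu> \<in> space \<N>. restr \<mu> (Bs n) \<in> {\<nu> \<in> space \<N>. emeasure \<nu> C \<in> S}} \<in> E"
          unfolding E_def by blast
        moreover have "(\<lambda>\<mu>. emeasure (restr \<mu> (Bs n)) C) -` S \<inter> space (sigma (space \<N>) E)
            = {\<mu> \<in> space \<N>. restr \<mu> (Bs n) \<in> {\<nu> \<in> space \<N>. emeasure \<nu> C \<in> S}}"
          by auto
        ultimately show "(\<lambda>\<mu>. emeasure (restr \<mu> (Bs n)) C) -` S \<inter> space (sigma (space \<N>) E)
            \<in> sets (sigma (space \<N>) E)" by simp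
      qed simp
      then have "(\<lambda>\<mu>. SUP n. emeasure (restr \<mu> (Bs n)) C) \<in> borel_measurable (sigma (space \<N>) E)"
        by measurable
      then show "(\<lambda>\<mu>. emeasure \<mu> C) \<in> borel_measurable (sigma (space \<N>) E)"
        by (rule measurable_cong[THEN iffD1, rotated])
           (simp add: emeasure_restr_counting SUP_emeasure_Bs sets_counting)
    qed simp
    from measurable_sets[OF this] show "sets \<N> \<subseteq> sigma_sets (space \<N>) E"
      using sets.sets_into_space[of _ \<N>] by (auto simp: Int_absorb2)
    have "a \<in> sets \<N>" if aE: "a \<in> E" for a
    proof -
      obtain n A where a: "a = {\<mu> \<in> space \<N>. restr \<mu> (Bs n) \<in> A}" and [measurable]: "A \<in> sets \<N>"
        using aE unfolding E_def by blast
      show ?thesis unfolding a by measurable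
    qed
    then show "sigma_sets (space \<N>) E \<subseteq> sets \<N>" by (intro sets.sigma_sets_subset) auto
  qed
  have top: "space \<N> \<in> E"
    unfolding E_def by (intro CollectI exI[of _ 0] exI[of _ "space \<N>"]) auto
  show ?thesis
  proof (rule measure_eqI_generator_eq[OF stable sub, where A = "\<lambda>_. space \<N>"])
    fix X assume "X \<in> E"
    then show "emeasure Q X = emeasure Q' X" unfolding E_def using eq by blast
  qed (use Q fin gen top in auto)
qed

lemma add_restr_Diff:
  assumes "\<mu> \<in> space \<N>" "D \<in> sets M"
  shows "add_measure (restr \<mu> D) (restr \<mu> (space M - D)) = \<mu>"
proof (rule counting_eqI)
  fix C assume C: "C \<in> sets M"
  have "emeasure \<mu> (C \<inter> D) + emeasure \<mu> (C \<inter> (space M - D)) = emeasure \<mu> ((C \<inter> D) \<union> (C \<inter> (space M - D)))"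
    using assms C by (intro plus_emeasure) (auto simp: sets_counting)
  also have "(C \<inter> D) \<union> (C \<inter> (space M - D)) = C" using sets.sets_into_space[OF C] by auto
  finally show "emeasure (add_measure (restr \<mu> D) (restr \<mu> (space M - D))) C = emeasure \<mu> C"
    using assms C by (simp add: emeasure_add_counting emeasure_restr_counting)
qed (use assms in auto)

lemma restr_add_measure:
  assumes "\<mu> \<in> space \<N>" "\<psi> \<in> space \<N>" "C \<in> sets M"
  shows "restr (add_measure \<mu> \<psi>) C = add_measure (restr \<mu> C) (restr \<psi> C)"
  using assms by (intro counting_eqI) (auto simp: emeasure_add_counting emeasure_restr_counting)

lemma restr_restr:
  assumes "\<mu> \<in> space \<N>" "C \<in> sets M" "D \<in> sets M"
  shows "restr (restr \<mu> C) D = restr \<mu> (C \<inter> D)"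
  using assms by (intro counting_eqI) (auto simp: emeasure_restr_counting Int_ac)

lemma restr_empty: "\<mu> \<in> space \<N> \<Longrightarrow> restr \<mu> {} = null_measure M"
  by (intro counting_eqI) (auto simp: emeasure_restr_counting)

lemma null_add: "\<mu> \<in> space \<N> \<Longrightarrow> add_measure (null_measure M) \<mu> = \<mu>"
  by (rule counting_eqI) (auto simp: emeasure_add_counting)

section \<open>Deterministic properties of stopping sets\<close>

lemma stopping_set_region:
  assumes "stopping_set M Bs Z" shows "measurable_region Z"
proof -
  have "(\<lambda>(x, \<mu>). indicator (Z \<mu>) x :: real) -` {1} \<inter> space (M \<Otimes>\<^sub>M \<N>) \<in> sets (M \<Otimes>\<^sub>M \<N>)"
    using assms unfolding stopping_set_def by (intro measurable_sets[of _ _ borel]) auto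
  also have "(\<lambda>(x, \<mu>). indicator (Z \<mu>) x :: real) -` {1} \<inter> space (M \<Otimes>\<^sub>M \<N>)
      = {z \<in> space (M \<Otimes>\<^sub>M \<N>). fst z \<in> Z (snd z)}"
    by (auto simp: indicator_def split: if_splits)
  finally show ?thesis
    using assms by (auto simp: measurable_region_def stopping_set_def space_counting_algebra)
qed

lemma stopping_setD:
  assumes "stopping_set M Bs Z" "\<mu> \<in> space \<N>" "\<psi> \<in> space \<N>"
  shows "Z (add_measure (restr \<mu> (Z \<mu>)) (restr \<psi> (space M - Z \<mu>))) = Z \<mu>"
  using assms unfolding stopping_set_def space_counting_algebra by metis

text \<open>The stopping property with \<open>\<psi>\<close> null. It makes \<open>Z\<close> a
  function of the restriction to \<open>Z\<close>, hence known under the conditioning.\<close>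

lemma stopping_set_restr:
  assumes Z: "stopping_set M Bs Z" and \<mu>: "\<mu> \<in> space \<N>"
  shows "Z (restr \<mu> (Z \<mu>)) = Z \<mu>"
proof -
  have [simp]: "Z \<mu> \<in> sets M" using measurable_region_sets[OF stopping_set_region[OF Z] \<mu>] .
  have "restr (null_measure M) (space M - Z \<mu>) = null_measure M"
    by (intro restr_eq_null) auto
  then show ?thesis
    using stopping_setD[OF Z \<mu> null_counting] \<mu> by (simp add: add_null)
qed

text \<open>The stopping property with the two configurations in either role: if \<open>x\<close> is
  outside \<open>Z \<mu>\<close>, the enlarged one is pasted outside \<open>Z \<mu>\<close>; if
  \<open>x\<close> is outside the region of the enlarged one, \<open>\<mu>\<close> is pasted outside
  that region. Either way the result is the pasted configuration itself.\<close>

lemma stopping_set_add_point: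
  assumes Z: "stopping_set M Bs Z" and \<mu>: "\<mu> \<in> space \<N>" and x: "x \<in> space M"
    and "x \<notin> Z \<mu> \<or> x \<notin> Z (add_point \<mu> x)"
  shows "Z (add_point \<mu> x) = Z \<mu>"
  using assms(4)
proof
  note sets_Z = measurable_region_sets[OF stopping_set_region[OF Z]]
  have [simp]: "add_point \<mu> x \<in> space \<N>" using \<mu> x by simp
  {
    assume "x \<notin> Z \<mu>"
    moreover have "Z \<mu> \<in> sets M" using \<mu> by (rule sets_Z)
    ultimately have "add_measure (restr \<mu> (Z \<mu>)) (restr (add_point \<mu> x) (space M - Z \<mu>)) = add_point \<mu> x"
      using \<mu> x by (simp add: restr_add_point add_point_assoc add_restr_Diff)
    with stopping_setD[OF Z \<mu>, of "add_point \<mu> x"] show ?thesis by simp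
  next
    assume "x \<notin> Z (add_point \<mu> x)"
    moreover have "Z (add_point \<mu> x) \<in> sets M" by (rule sets_Z) simp
    ultimately have "add_measure (restr (add_point \<mu> x) (Z (add_point \<mu> x))) (restr \<mu> (space M - Z (add_point \<mu> x))) = \<mu>"
      using \<mu> x by (simp add: restr_add_point add_restr_Diff)
    with stopping_setD[OF Z, of "add_point \<mu> x" \<mu>] \<mu> show ?thesis by simp
  }
qed

text \<open>Pasting outside the union leaves the configuration unchanged on each
  \<open>Zs n \<mu>\<close>. The pasted configuration is therefore also a pasting outside
  \<open>Zs n \<mu>\<close>, with itself as the second measure, so the stopping property of
  \<open>Zs n\<close> fixes \<open>Zs n\<close> for every \<open>n\<close>, and with them the
  union.\<close>

lemma stopping_set_UN:
  assumes Zs: "\<And>n::nat. stopping_set M Bs (Zs n)"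
    and Z: "\<And>\<mu>. \<mu> \<in> counting_measures M Bs \<Longrightarrow> Z \<mu> = (\<Union>n. Zs n \<mu>)"
  shows "stopping_set M Bs Z"
proof -
  note sets_Zs = measurable_region_sets[OF stopping_set_region[OF Zs]]
  have sets_Z: "Z \<mu> \<in> sets M" if "\<mu> \<in> space \<N>" for \<mu>
    using that Z[of \<mu>] sets_Zs[OF that] by (auto simp: space_counting_algebra)
  have "(\<Union>n. {z \<in> space (M \<Otimes>\<^sub>M \<N>). fst z \<in> Zs n (snd z)}) \<in> sets (M \<Otimes>\<^sub>M \<N>)"
    using stopping_set_region[OF Zs] by (intro sets.countable_UN) (auto simp: measurable_region_def)
  also have "(\<Union>n. {z \<in> space (M \<Otimes>\<^sub>M \<N>). fst z \<in> Zs n (snd z)}) = {z \<in> space (M \<Otimes>\<^sub>M \<N>). fst z \<in> Z (snd z)}"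
    using Z by (auto simp: space_pair_measure space_counting_algebra)
  finally have "indicator {z \<in> space (M \<Otimes>\<^sub>M \<N>). fst z \<in> Z (snd z)} \<in> borel_measurable (M \<Otimes>\<^sub>M \<N>)"
    by (rule borel_measurable_indicator)
  then have graph: "(\<lambda>(x, \<mu>). indicator (Z \<mu>) x :: real) \<in> borel_measurable (M \<Otimes>\<^sub>M \<N>)"
    by (rule measurable_cong[THEN iffD1, rotated]) (auto split: split_indicator)
  have "Z (add_measure (restr \<mu> (Z \<mu>)) (restr \<psi> (space M - Z \<mu>))) = Z \<mu>"
    if \<mu>: "\<mu> \<in> space \<N>" and \<psi>: "\<psi> \<in> space \<N>" for \<mu> \<psi>
  proof -
    let ?\<nu> = "add_measure (restr \<mu> (Z \<mu>)) (restr \<psi> (space M - Z \<mu>))"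
    have \<nu>: "?\<nu> \<in> space \<N>" using \<mu> \<psi> sets_Z[OF \<mu>] by simp
    have "Zs n ?\<nu> = Zs n \<mu>" for n
    proof -
      have sub: "Zs n \<mu> \<subseteq> Z \<mu>" using Z \<mu> by (auto simp: space_counting_algebra)
      have "restr ?\<nu> (Zs n \<mu>) = restr \<mu> (Zs n \<mu>)"
      proof -
        have "(space M - Z \<mu>) \<inter> Zs n \<mu> = {}" "Z \<mu> \<inter> Zs n \<mu> = Zs n \<mu>" using sub by auto
        then show ?thesis
          using \<mu> \<psi> sets_Z[OF \<mu>] sets_Zs[OF \<mu>]
          by (simp add: restr_add_measure restr_restr restr_empty add_null)
      qed
      then have "add_measure (restr \<mu> (Zs n \<mu>)) (restr ?\<nu> (space M - Zs n \<mu>)) = ?\<nu>"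
        using add_restr_Diff[OF \<nu> sets_Zs[OF \<mu>]] by metis
      then show ?thesis using stopping_setD[OF Zs \<mu> \<nu>, of n] by simp
    qed
    then show ?thesis using Z \<mu> \<nu> by (simp add: space_counting_algebra)
  qed
  then show ?thesis
    using sets_Z graph unfolding stopping_set_def space_counting_algebra[symmetric] by auto
qed

end

section \<open>The Poisson law of a restricted intensity: existence and uniqueness\<close>

context poisson
begin

text \<open>The right-hand side involves the intensity and the window but not the process, so all
  Poisson processes with this intensity have the same law in each window.\<close>

lemma law_restr_Bs:
  assumes [measurable]: "A \<in> sets \<N>"
  shows "emeasure P {\<omega> \<in> space P. restr (\<eta> \<omega>) (Bs n) \<in> A} =
    ennreal (exp (- measure \<Lambda> (Bs n))) * insert_exp (\<lambda>_. Bs n) (indicator A) (null_measure M)"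
proof -
  have "emeasure P {\<omega> \<in> space P. restr (\<eta> \<omega>) (Bs n) \<in> A}
      = (\<integral>\<^sup>+\<omega>. indicator {\<omega> \<in> space P. restr (\<eta> \<omega>) (Bs n) \<in> A} \<omega> \<partial>P)"
    by (rule nn_integral_indicator[symmetric]) measurable
  also have "\<dots> = (\<integral>\<^sup>+\<omega>. indicator A (add_measure (null_measure M) (restr (\<eta> \<omega>) (Bs n))) \<partial>P)"
    by (intro nn_integral_cong) (auto simp: null_add split: split_indicator)
  also have "\<dots> = ennreal (exp (- measure \<Lambda> (Bs n))) * insert_exp (\<lambda>_. Bs n) (indicator A) (null_measure M)"
    by (rule expansion_const[where n = n]) auto
  finally show ?thesis .
qed

text \<open>Existence of the process whose law \<open>poisson_law\<close> describes. The conclusion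
  is a locale instance, so that \<open>law_restr_Bs\<close> becomes available for it.\<close>

lemma poisson_restr:
  assumes C [measurable]: "C \<in> sets M"
  shows "poisson M Bs (restr \<Lambda> C) (distr P \<N> (\<lambda>\<omega>. restr (\<eta> \<omega>) C)) (\<lambda>\<mu>. \<mu>)"
proof -
  let ?Q = "distr P \<N> (\<lambda>\<omega>. restr (\<eta> \<omega>) C)"
  have restr_meas [measurable]: "(\<lambda>\<omega>. restr (\<eta> \<omega>) C) \<in> measurable P \<N>" by measurable
  interpret Q: prob_space ?Q by (rule prob_space_distr) simp
  have \<Lambda>C: "emeasure (restr \<Lambda> C) B = emeasure \<Lambda> (B \<inter> C)" if "B \<in> sets M" for B
    using that by (simp add: emeasure_restr)
  have "emeasure (restr \<Lambda> C) B < \<infinity>" if B: "B \<in> bounded_sets M Bs" for B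
  proof -
    obtain n where "B \<in> sets M" "B \<inter> C \<subseteq> Bs n" using B unfolding bounded_sets_iff by auto
    then show ?thesis using Lambda_bounded[of "B \<inter> C" n] by (simp add: \<Lambda>C)
  qed
  then have "locally_finite M Bs (restr \<Lambda> C)" by (simp add: locally_finite_def)
  moreover have "poisson_distributed ?Q (\<lambda>\<mu>. emeasure \<mu> B) (emeasure (restr \<Lambda> C) B)" if [measurable]: "B \<in> sets M" for B
  proof -
    have "measure ?Q {\<mu> \<in> space ?Q. emeasure \<mu> B = c} = prob {\<omega> \<in> space P. emeasure (\<eta> \<omega>) (B \<inter> C) = c}" for c
      by (subst measure_distr) (auto simp: emeasure_restr_counting intro!: arg_cong[where f = prob])
    moreover have "poisson_distributed P (\<lambda>\<omega>. emeasure (\<eta> \<omega>) (B \<inter> C)) (emeasure \<Lambda> (B \<inter> C))"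
      using pp by (auto simp: poisson_process_def)
    ultimately show ?thesis
      using \<Lambda>C[OF that] unfolding poisson_distributed_def by (simp only: space_distr)
  qed
  moreover have "Q.indep_vars (\<lambda>_. borel) (\<lambda>i \<mu>. emeasure \<mu> (B i)) {..<m}"
    if B: "\<forall>i<m. B i \<in> sets M" "disjoint_family_on B {..<m}" for m :: nat and B
  proof (rule Q.indep_vars_finiteI)
    fix S :: "nat \<Rightarrow> ennreal set" assume S: "\<And>i. i \<in> {..<m} \<Longrightarrow> S i \<in> sets borel" and ne: "{..<m} \<noteq> {}"
    define V where "V i = (\<lambda>\<mu>. emeasure \<mu> (B i)) -` S i \<inter> space ?Q" for i
    have V: "V i \<in> sets \<N>" if "i < m" for i
      unfolding V_def using that B S
      by (auto intro!: measurable_sets[where A = borel] measurable_emeasure_counting_algebra)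
    have vimage: "(\<lambda>\<omega>. restr (\<eta> \<omega>) C) -` V i \<inter> space P
        = (\<lambda>\<omega>. emeasure (\<eta> \<omega>) (B i \<inter> C)) -` S i \<inter> space P" if "i < m" for i
      using that B by (auto simp: V_def emeasure_restr_counting)
    have ind: "indep_vars (\<lambda>_. borel) (\<lambda>i \<omega>. emeasure (\<eta> \<omega>) (B i \<inter> C)) {..<m}"
      using B by (intro indep_counts) (auto simp: disjoint_family_on_def)
    have "measure ?Q (\<Inter>i<m. V i) = prob (\<Inter>i<m. (\<lambda>\<omega>. restr (\<eta> \<omega>) C) -` V i \<inter> space P)"
    proof -
      have "(\<lambda>\<omega>. restr (\<eta> \<omega>) C) -` (\<Inter>i<m. V i) \<inter> space P = (\<Inter>i<m. (\<lambda>\<omega>. restr (\<eta> \<omega>) C) -` V i \<inter> space P)"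
        using ne by auto
      moreover have "(\<Inter>i<m. V i) \<in> sets \<N>" using V ne by (intro sets.finite_INT) auto
      ultimately show ?thesis using measure_distr[OF restr_meas, of "\<Inter>i<m. V i"] by simp
    qed
    also have "\<dots> = prob (\<Inter>i<m. (\<lambda>\<omega>. emeasure (\<eta> \<omega>) (B i \<inter> C)) -` S i \<inter> space P)"
      by (intro arg_cong[where f = prob] INF_cong refl) (simp only: vimage lessThan_iff)
    also have "\<dots> = (\<Prod>i<m. prob ((\<lambda>\<omega>. emeasure (\<eta> \<omega>) (B i \<inter> C)) -` S i \<inter> space P))"
      using S ne by (intro indep_varsD_finite[OF ind]) auto
    also have "\<dots> = (\<Prod>i<m. measure ?Q (V i))"
      using measure_distr[OF restr_meas V] vimage by (intro prod.cong refl) simp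
    finally show "measure ?Q (\<Inter>i<m. (\<lambda>\<mu>. emeasure \<mu> (B i)) -` S i \<inter> space ?Q)
      = (\<Prod>i<m. measure ?Q ((\<lambda>\<mu>. emeasure \<mu> (B i)) -` S i \<inter> space ?Q))" by (simp only: V_def)
  qed (use B in \<open>auto simp: measurable_emeasure_counting_algebra\<close>)
  ultimately show ?thesis
    by unfold_locales (auto simp: poisson_process_def Q.prob_space_axioms)
qed

text \<open>Existence is \<open>poisson_restr\<close>; uniqueness holds because two processes of
  equal intensity agree in every window. The descriptive definition thereby becomes an image measure
  that can be integrated against.\<close>

lemma poisson_law_restr:
  assumes C [measurable]: "C \<in> sets M"
  shows "poisson_law M Bs (restr \<Lambda> C) = distr P \<N> (\<lambda>\<omega>. restr (\<eta> \<omega>) C)"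
  unfolding poisson_law_def
proof (rule the_equality)
  let ?Q = "distr P \<N> (\<lambda>\<omega>. restr (\<eta> \<omega>) C)"
  interpret Q: poisson M Bs "restr \<Lambda> C" ?Q "\<lambda>\<mu>. \<mu>" by (rule poisson_restr[OF C])
  show "sets ?Q = sets \<N> \<and> poisson_process M Bs (restr \<Lambda> C) ?Q (\<lambda>\<mu>. \<mu>)"
    using Q.pp by simp
  fix Q' assume Q': "sets Q' = sets \<N> \<and> poisson_process M Bs (restr \<Lambda> C) Q' (\<lambda>\<mu>. \<mu>)"
  then interpret Q': poisson M Bs "restr \<Lambda> C" Q' "\<lambda>\<mu>. \<mu>"
    using Q.lf by unfold_locales auto
  have sp: "space Q' = space \<N>" using Q' by (intro sets_eq_imp_space_eq) simp
  show "Q' = ?Q"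
  proof (rule measure_eqI_restr_Bs)
    show "emeasure Q' (space \<N>) \<noteq> \<infinity>" using Q'.emeasure_space_1 by (simp add: sp)
    fix n A assume "A \<in> sets \<N>"
    note Q.law_restr_Bs[OF this, of n] Q'.law_restr_Bs[OF this, of n]
    then show "emeasure Q' {\<mu> \<in> space \<N>. restr \<mu> (Bs n) \<in> A} = emeasure ?Q {\<mu> \<in> space \<N>. restr \<mu> (Bs n) \<in> A}"
      by (simp only: sp space_distr)
  qed (use Q' in auto)
qed

section \<open>Resampling outside a stopping set and the conditional law\<close>

lemma stopping_set_stable:
  assumes Z: "stopping_set M Bs Z" shows "stable_region n (\<lambda>\<mu>. Bs n - Z \<mu>)"
  unfolding stable_region_def
proof (intro conjI ballI impI)
  fix \<mu> x assume "\<mu> \<in> space \<N>" "x \<in> space M" "x \<in> Bs n - Z \<mu> \<or> x \<in> Bs n - Z (add_point \<mu> x)"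
  \<comment> \<open>A point of the difference lies outside \<open>Z\<close> either before or after
    the insertion, which is the hypothesis of \<open>stopping_set_add_point\<close>.\<close>
  then show "Bs n - Z (add_point \<mu> x) = Bs n - Z \<mu>"
    using stopping_set_add_point[OF Z, of \<mu> x] by auto
qed (auto intro: measurable_region_Diff stopping_set_region[OF Z])

text \<open>Seen through \<open>Bs n\<close>, resampling on \<open>Bs n - Z\<close> cannot be told
  from resampling on the whole complement of \<open>Z\<close>. The bounded statement thus gives
  equality of laws in each window, and the windows determine the law.\<close>

theorem resampling_stopping_set:
  assumes Z: "stopping_set M Bs Z" and F [measurable]: "F \<in> borel_measurable \<N>"
  shows "(\<integral>\<^sup>+\<omega>. F (\<eta> \<omega>) \<partial>P) =
    (\<integral>\<^sup>+\<omega>. \<integral>\<^sup>+\<omega>'. F (add_measure (restr (\<eta> \<omega>) (Z (\<eta> \<omega>))) (restr (\<eta> \<omega>') (space M - Z (\<eta> \<omega>)))) \<partial>P \<partial>P)"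
proof -
  interpret PP: pair_prob_space P P ..
  note reg = stopping_set_region[OF Z]
  note reg' = measurable_region_Diff[OF reg sets.top]
  let ?\<xi> = "\<lambda>z. add_measure (restr (\<eta> (fst z)) (Z (\<eta> (fst z)))) (restr (\<eta> (snd z)) (space M - Z (\<eta> (fst z))))"
  have [measurable]: "(\<lambda>z. restr (\<eta> (fst z)) (Z (\<eta> (fst z)))) \<in> measurable (P \<Otimes>\<^sub>M P) \<N>"
    by (rule measurable_restr_region[OF reg]) auto
  have [measurable]: "(\<lambda>z. restr (\<eta> (snd z)) (space M - Z (\<eta> (fst z)))) \<in> measurable (P \<Otimes>\<^sub>M P) \<N>"
    by (rule measurable_restr_region[OF reg']) auto
  have "distr P \<N> \<eta> = distr (P \<Otimes>\<^sub>M P) \<N> ?\<xi>"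
  proof (rule measure_eqI_restr_Bs)
    interpret D: prob_space "distr P \<N> \<eta>" by (rule prob_space_distr) simp
    show "emeasure (distr P \<N> \<eta>) (space \<N>) \<noteq> \<infinity>" using D.emeasure_space_1 by simp
    fix n A assume [measurable]: "A \<in> sets \<N>"
    let ?B = "{\<mu> \<in> space \<N>. restr \<mu> (Bs n) \<in> A}"
    have B [measurable]: "?B \<in> sets \<N>" by measurable
    have "emeasure (distr P \<N> \<eta>) ?B = (\<integral>\<^sup>+\<mu>. indicator ?B \<mu> \<partial>distr P \<N> \<eta>)" by simp
    also have "\<dots> = (\<integral>\<^sup>+\<omega>. indicator ?B (\<eta> \<omega>) \<partial>P)"
      by (rule nn_integral_distr) auto
    also have "\<dots> = (\<integral>\<^sup>+\<omega>. \<integral>\<^sup>+\<omega>'. indicator ?B (add_measure (restr (\<eta> \<omega>) (space M - (Bs n - Z (\<eta> \<omega>))))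
        (restr (\<eta> \<omega>') (Bs n - Z (\<eta> \<omega>)))) \<partial>P \<partial>P)"
      by (rule resampling[OF stopping_set_stable[OF Z]]) measurable
    also have "\<dots> = (\<integral>\<^sup>+\<omega>. \<integral>\<^sup>+\<omega>'. indicator ?B (?\<xi> (\<omega>, \<omega>')) \<partial>P \<partial>P)"
    proof (intro nn_integral_cong)
      fix \<omega> \<omega>' assume \<omega>: "\<omega> \<in> space P" "\<omega>' \<in> space P"
      let ?Z = "Z (\<eta> \<omega>)"
      have [simp]: "?Z \<in> sets M" using \<omega> by (intro measurable_region_sets[OF reg]) simp
      have [simp]: "space M - (Bs n - ?Z) \<in> sets M" "Bs n - ?Z \<in> sets M" "space M - ?Z \<in> sets M"
        by (intro sets.Diff sets.top sets_Bs; simp)+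
      have eq: "(space M - (Bs n - ?Z)) \<inter> Bs n = ?Z \<inter> Bs n" "(Bs n - ?Z) \<inter> Bs n = (space M - ?Z) \<inter> Bs n"
        using sets.sets_into_space[OF sets_Bs[of n]] by auto
      have "restr (add_measure (restr (\<eta> \<omega>) (space M - (Bs n - ?Z))) (restr (\<eta> \<omega>') (Bs n - ?Z))) (Bs n)
          = restr (?\<xi> (\<omega>, \<omega>')) (Bs n)"
        using \<omega> by (simp add: restr_add_measure restr_restr eq)
      then show "indicator ?B (add_measure (restr (\<eta> \<omega>) (space M - (Bs n - ?Z))) (restr (\<eta> \<omega>') (Bs n - ?Z)))
          = (indicator ?B (?\<xi> (\<omega>, \<omega>')) :: ennreal)"
        using \<omega> by (simp add: indicator_def)
    qed
    also have "\<dots> = (\<integral>\<^sup>+z. indicator ?B (?\<xi> z) \<partial>(P \<Otimes>\<^sub>M P))"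
      by (rule nn_integral_fst) measurable
    also have "\<dots> = (\<integral>\<^sup>+\<mu>. indicator ?B \<mu> \<partial>distr (P \<Otimes>\<^sub>M P) \<N> ?\<xi>)"
      by (rule nn_integral_distr[symmetric]) auto
    finally show "emeasure (distr P \<N> \<eta>) ?B = emeasure (distr (P \<Otimes>\<^sub>M P) \<N> ?\<xi>) ?B" by simp
  qed simp_all
  then have "(\<integral>\<^sup>+\<mu>. F \<mu> \<partial>distr P \<N> \<eta>) = (\<integral>\<^sup>+\<mu>. F \<mu> \<partial>distr (P \<Otimes>\<^sub>M P) \<N> ?\<xi>)" by simp
  then have "(\<integral>\<^sup>+\<omega>. F (\<eta> \<omega>) \<partial>P) = (\<integral>\<^sup>+z. F (?\<xi> z) \<partial>(P \<Otimes>\<^sub>M P))"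
    by (simp add: nn_integral_distr)
  also have "\<dots> = (\<integral>\<^sup>+\<omega>. \<integral>\<^sup>+\<omega>'. F (?\<xi> (\<omega>, \<omega>')) \<partial>P \<partial>P)"
    by (rule nn_integral_fst[symmetric]) measurable
  finally show ?thesis by simp
qed

text \<open>The candidate \<open>q (\<eta> \<omega>)\<close> depends on
  \<open>\<eta> \<omega>\<close> only through the region, which is a function of the conditioning
  variable. For an event \<open>S\<close> of the conditioning sigma-field, resampling the complement
  keeps the region and the inside part, so the indicator of \<open>S\<close> factors out and
  averaging over the copy leaves \<open>q\<close>.\<close>

theorem strong_markov:
  assumes Z: "stopping_set M Bs Z" and A [measurable]: "A \<in> sets \<N>"
  shows "AE \<omega> in P.
    real_cond_exp P (vimage_algebra (space P) (\<lambda>\<omega>. restr (\<eta> \<omega>) (Z (\<eta> \<omega>))) \<N>)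
      (\<lambda>\<omega>. indicator A (restr (\<eta> \<omega>) (space M - Z (\<eta> \<omega>)))) \<omega>
    = measure (poisson_law M Bs (restr \<Lambda> (space M - Z (\<eta> \<omega>)))) A"
proof -
  note reg = stopping_set_region[OF Z]
  note reg' = measurable_region_Diff[OF reg sets.top]
  have sets_Z: "Z \<mu> \<in> sets M" if "\<mu> \<in> space \<N>" for \<mu> using reg that by (rule measurable_region_sets)
  have [measurable]: "(\<lambda>\<mu>. restr \<mu> (Z \<mu>)) \<in> measurable \<N> \<N>"
    by (rule measurable_restr_region[OF reg]) auto
  have [measurable]: "(\<lambda>\<mu>. restr \<mu> (space M - Z \<mu>)) \<in> measurable \<N> \<N>"
    by (rule measurable_restr_region[OF reg']) auto
  let ?\<rho> = "\<lambda>\<omega>. restr (\<eta> \<omega>) (Z (\<eta> \<omega>))" and ?\<sigma> = "\<lambda>\<omega>. restr (\<eta> \<omega>) (space M - Z (\<eta> \<omega>))"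
  let ?G = "vimage_algebra (space P) ?\<rho> \<N>"
  have \<rho> [measurable]: "?\<rho> \<in> measurable P \<N>" by measurable
  have \<sigma> [measurable]: "?\<sigma> \<in> measurable P \<N>" by measurable
  interpret G: finite_measure_subalgebra P ?G
  proof
    show "subalgebra P ?G"
      using measurable_sets[OF \<rho>] measurable_space[OF \<rho>]
      by (auto simp: subalgebra_def sets_vimage_algebra2)
  qed
  define q where "q \<mu> = (\<integral>\<^sup>+\<omega>. indicator A (restr (\<eta> \<omega>) (space M - Z \<mu>)) \<partial>P)" for \<mu>
  have q [measurable]: "q \<in> borel_measurable \<N>"
  proof -
    have [measurable]: "(\<lambda>z. restr (\<eta> (snd z)) (space M - Z (fst z))) \<in> measurable (\<N> \<Otimes>\<^sub>M P) \<N>"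
      by (rule measurable_restr_region[OF reg']) auto
    have "(\<lambda>\<mu>. \<integral>\<^sup>+\<omega>. indicator A (restr (\<eta> (snd (\<mu>, \<omega>))) (space M - Z (fst (\<mu>, \<omega>)))) \<partial>P) \<in> borel_measurable \<N>"
      by measurable
    then show ?thesis by (simp add: q_def[abs_def])
  qed
  have q_le_1: "q \<mu> \<le> 1" for \<mu>
  proof -
    have "q \<mu> \<le> (\<integral>\<^sup>+\<omega>. 1 \<partial>P)" unfolding q_def by (intro nn_integral_mono) (auto split: split_indicator)
    then show ?thesis by (simp add: emeasure_space_1)
  qed
  \<comment> \<open>For fixed \<open>\<mu>\<close> the region is deterministic, so
    \<open>poisson_law_restr\<close> identifies the average over the copy with a Poisson
    probability.\<close>
  have law: "measure (poisson_law M Bs (restr \<Lambda> (space M - Z \<mu>))) A = enn2real (q \<mu>)"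
    if \<mu>: "\<mu> \<in> space \<N>" for \<mu>
  proof -
    let ?C = "space M - Z \<mu>"
    have C [measurable]: "?C \<in> sets M" using sets_Z[OF \<mu>] by simp
    have "emeasure (distr P \<N> (\<lambda>\<omega>. restr (\<eta> \<omega>) ?C)) A = (\<integral>\<^sup>+\<nu>. indicator A \<nu> \<partial>distr P \<N> (\<lambda>\<omega>. restr (\<eta> \<omega>) ?C))"
      by simp
    also have "\<dots> = q \<mu>"
      unfolding q_def by (rule nn_integral_distr) measurable
    finally show ?thesis unfolding poisson_law_restr[OF C] measure_def by simp
  qed
  have q_\<rho>: "q (?\<rho> \<omega>) = q (\<eta> \<omega>)" if "\<omega> \<in> space P" for \<omega>
    using that stopping_set_restr[OF Z, of "\<eta> \<omega>"] by (simp add: q_def)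
  let ?f = "\<lambda>\<omega>. indicator A (?\<sigma> \<omega>) :: real" and ?g = "\<lambda>\<omega>. enn2real (q (\<eta> \<omega>))"
  have "AE \<omega> in P. real_cond_exp P ?G ?f \<omega> = ?g \<omega>"
  proof (rule G.real_cond_exp_charact)
    show "integrable P ?f" by (rule integrable_const_bound[of _ 1]) auto
    have g_le: "?g \<omega> \<le> 1" for \<omega> using q_le_1 by (metis enn2real_leI ennreal_1 zero_le_one)
    show "integrable P ?g" using g_le by (intro integrable_const_bound[of _ 1]) auto
    have "(\<lambda>\<omega>. enn2real (q (?\<rho> \<omega>))) \<in> borel_measurable ?G"
      by (rule measurable_compose[OF measurable_vimage_algebra1])
         (use measurable_space[OF \<rho>] in auto)
    then show "?g \<in> borel_measurable ?G"
      by (rule measurable_cong[THEN iffD1, rotated]) (simp add: q_\<rho>)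
    fix S assume "S \<in> sets ?G"
    then obtain C where C [measurable]: "C \<in> sets \<N>" and S: "S = ?\<rho> -` C \<inter> space P"
      using measurable_space[OF \<rho>] by (auto simp: sets_vimage_algebra2)
    have [measurable]: "S \<in> sets P" unfolding S by (rule measurable_sets[OF \<rho> C])
    have "(\<integral>\<^sup>+\<omega>. indicator C (?\<rho> \<omega>) * indicator A (?\<sigma> \<omega>) \<partial>P)
        = (\<integral>\<^sup>+\<omega>. \<integral>\<^sup>+\<omega>'. indicator C (?\<rho> \<omega>) * indicator A (restr (\<eta> \<omega>') (space M - Z (\<eta> \<omega>))) \<partial>P \<partial>P)"
    proof -
      have "(\<integral>\<^sup>+\<omega>. indicator C (?\<rho> \<omega>) * indicator A (?\<sigma> \<omega>) \<partial>P) =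
        (\<integral>\<^sup>+\<omega>. \<integral>\<^sup>+\<omega>'. (\<lambda>\<mu>. indicator C (restr \<mu> (Z \<mu>)) * indicator A (restr \<mu> (space M - Z \<mu>)))
          (add_measure (restr (\<eta> \<omega>) (Z (\<eta> \<omega>))) (restr (\<eta> \<omega>') (space M - Z (\<eta> \<omega>)))) \<partial>P \<partial>P)"
        by (rule resampling_stopping_set[OF Z]) measurable
      also have "\<dots> = (\<integral>\<^sup>+\<omega>. \<integral>\<^sup>+\<omega>'. indicator C (?\<rho> \<omega>) * indicator A (restr (\<eta> \<omega>') (space M - Z (\<eta> \<omega>))) \<partial>P \<partial>P)"
      proof (intro nn_integral_cong)
        fix \<omega> \<omega>' assume \<omega>: "\<omega> \<in> space P" "\<omega>' \<in> space P"
        let ?\<mu> = "add_measure (restr (\<eta> \<omega>) (Z (\<eta> \<omega>))) (restr (\<eta> \<omega>') (space M - Z (\<eta> \<omega>)))"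
        \<comment> \<open>By the stopping property the region survives the pasting, so the
          restrictions of the pasted configuration are taken along the region of
          \<open>\<eta> \<omega>\<close>: one returns the old inside, the other the new
          outside.\<close>
        have Z\<mu>: "Z ?\<mu> = Z (\<eta> \<omega>)" using \<omega> by (intro stopping_setD[OF Z]) auto
        have [simp]: "Z (\<eta> \<omega>) \<in> sets M" using \<omega> by (intro sets_Z) simp
        have [simp]: "space M - Z (\<eta> \<omega>) \<in> sets M" by (intro sets.Diff sets.top) simp
        have [simp]: "Z (\<eta> \<omega>) \<inter> (space M - Z (\<eta> \<omega>)) = {}" "(space M - Z (\<eta> \<omega>)) \<inter> Z (\<eta> \<omega>) = {}" by auto
        have "restr ?\<mu> (Z (\<eta> \<omega>)) = ?\<rho> \<omega>"
          "restr ?\<mu> (space M - Z (\<eta> \<omega>)) = restr (\<eta> \<omega>') (space M - Z (\<eta> \<omega>))"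
          using \<omega> by (simp_all add: restr_add_measure restr_restr restr_empty add_null null_add)
        then show "indicator C (restr ?\<mu> (Z ?\<mu>)) * indicator A (restr ?\<mu> (space M - Z ?\<mu>))
          = (indicator C (?\<rho> \<omega>) * indicator A (restr (\<eta> \<omega>') (space M - Z (\<eta> \<omega>))) :: ennreal)"
          unfolding Z\<mu> by simp
      qed
      finally show ?thesis .
    qed
    also have "\<dots> = (\<integral>\<^sup>+\<omega>. indicator C (?\<rho> \<omega>) * q (\<eta> \<omega>) \<partial>P)"
    proof (intro nn_integral_cong)
      fix \<omega> assume "\<omega> \<in> space P"
      then have [measurable]: "space M - Z (\<eta> \<omega>) \<in> sets M" using sets_Z[of "\<eta> \<omega>"] by simp
      show "(\<integral>\<^sup>+\<omega>'. indicator C (?\<rho> \<omega>) * indicator A (restr (\<eta> \<omega>') (space M - Z (\<eta> \<omega>))) \<partial>P)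
          = indicator C (?\<rho> \<omega>) * q (\<eta> \<omega>)"
        unfolding q_def by (rule nn_integral_cmult) measurable
    qed
    finally have eq: "(\<integral>\<^sup>+\<omega>. indicator C (?\<rho> \<omega>) * indicator A (?\<sigma> \<omega>) \<partial>P)
        = (\<integral>\<^sup>+\<omega>. indicator C (?\<rho> \<omega>) * q (\<eta> \<omega>) \<partial>P)" .
    have ind: "indicator S \<omega> = (indicator C (?\<rho> \<omega>) :: real)" if "\<omega> \<in> space P" for \<omega>
      using that by (auto simp: S split: split_indicator)
    \<comment> \<open>The identity was obtained for extended nonnegative integrals; as
      \<open>q\<close> is at most one, it carries over to the real integrals that characterise
      \<open>real_cond_exp\<close>.\<close>
    have "(\<integral>\<omega>\<in>S. ?f \<omega> \<partial>P) = enn2real (\<integral>\<^sup>+\<omega>. ennreal (indicator S \<omega> * ?f \<omega>) \<partial>P)"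
      unfolding set_lebesgue_integral_def real_scaleR_def by (rule integral_eq_nn_integral) auto
    also have "(\<integral>\<^sup>+\<omega>. ennreal (indicator S \<omega> * ?f \<omega>) \<partial>P) = (\<integral>\<^sup>+\<omega>. indicator C (?\<rho> \<omega>) * indicator A (?\<sigma> \<omega>) \<partial>P)"
      by (intro nn_integral_cong) (auto simp: ind split: split_indicator)
    also have "\<dots> = (\<integral>\<^sup>+\<omega>. ennreal (indicator S \<omega> * ?g \<omega>) \<partial>P)"
      unfolding eq
    proof (intro nn_integral_cong)
      fix \<omega> assume "\<omega> \<in> space P"
      have "q (\<eta> \<omega>) < \<infinity>" using q_le_1[of "\<eta> \<omega>"] by (simp add: le_less_trans)
      then show "indicator C (?\<rho> \<omega>) * q (\<eta> \<omega>) = ennreal (indicator S \<omega> * ?g \<omega>)"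
        using \<open>\<omega> \<in> space P\<close> by (auto simp: ind split: split_indicator)
    qed
    also have "enn2real \<dots> = (\<integral>\<omega>\<in>S. ?g \<omega> \<partial>P)"
      unfolding set_lebesgue_integral_def real_scaleR_def by (rule integral_eq_nn_integral[symmetric]) auto
    finally show "(\<integral>\<omega>\<in>S. ?f \<omega> \<partial>P) = (\<integral>\<omega>\<in>S. ?g \<omega> \<partial>P)" .
  qed
  then show ?thesis by (rule AE_mp) (auto intro!: AE_I2 simp: law)
qed

end

theorem theoremA6:
  fixes M :: "'a measure" and Bs :: "nat \<Rightarrow> 'a set"
    and \<Lambda> :: "'a measure"
    and P :: "'w measure" and \<eta> :: "'w \<Rightarrow> 'a measure"
    and Zs :: "nat \<Rightarrow> 'a measure \<Rightarrow> 'a set" and Z :: "'a measure \<Rightarrow> 'a set"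
  assumes "borel_isomorphic_space M"
    and "localizing_seq M Bs"
    and "locally_finite M Bs \<Lambda>"
    and "poisson_process M Bs \<Lambda> P \<eta>"
    and "\<And>n. stopping_set M Bs (Zs n)"
    and "Z \<in> counting_measures M Bs \<rightarrow> sets M"
    and "\<And>n \<mu>. \<mu> \<in> counting_measures M Bs \<Longrightarrow> Zs n \<mu> \<subseteq> Zs (Suc n) \<mu>"
    and "\<And>\<mu>. \<mu> \<in> counting_measures M Bs \<Longrightarrow> Z \<mu> = (\<Union>n. Zs n \<mu>)"
  shows "stopping_set M Bs Z \<and>
    ((\<forall>n. \<P>(\<omega> in P. emeasure (\<eta> \<omega>) (Zs n (\<eta> \<omega>)) < \<infinity>) = 1) \<longrightarrow>
      (\<forall>A\<in>sets (counting_algebra M Bs).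
        AE \<omega> in P.
          real_cond_exp P
            (vimage_algebra (space P) (\<lambda>\<omega>. restr (\<eta> \<omega>) (Z (\<eta> \<omega>))) (counting_algebra M Bs))
            (\<lambda>\<omega>. indicator A (restr (\<eta> \<omega>) (space M - Z (\<eta> \<omega>)))) \<omega>
          = measure (poisson_law M Bs (restr \<Lambda> (space M - Z (\<eta> \<omega>)))) A))"
proof -
  interpret poisson M Bs \<Lambda> P \<eta>
    using assms by unfold_locales
  have "stopping_set M Bs Z" using assms(5,8) by (rule stopping_set_UN)
  \<comment> \<open>With \<open>Z\<close> known to be a stopping set, \<open>strong_markov\<close>
    is applied to \<open>Z\<close> itself rather than to each \<open>Zs n\<close>.\<close>
  then show ?thesis using strong_markov by blast
qed

end
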